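(* Let $X$ be a Banach space with a normalized Schauder basis $(e_i)$ which contains a subspace $Y$ that is almost transitive (in the norm inherited from $X$). Let $r\in\mathrm{FR}(Y)$. Then for all $n\ge2$ and all nonzero scalars $a_1,\dots,a_{n-1}$ there exists $(b_i)_{i=1}^n\in\{X,(e_i)\}_n$ such that for all scalars $\lambda$ and all $1\le k<n$, $$\Big\|\sum_{i=1}^k a_ib_i+\lambda b_{k+1}\Big\|=\Big(\sum_{i=1}^k|a_i|^r+|\lambda|^r\Big)^{1/r}$$ (for $r=\infty$ the right-hand side is read as $\max(|a_1|,\dots,|a_k|,|\lambda|)$). In particular, the unit vector basis of $\ell_r^2$ belongs to $\{X,(e_i)\}_2$.
   Context: Banach spaces are infinite-dimensional, real or complex, and "subspace" means closed infinite-dimensional linear subspace. $Y$ is almost transitive if for every $y$ in the unit sphere of $Y$ the orbit of $y$ under the group of surjective linear isometries of $Y$ is norm dense in the unit sphere of $Y$. $\mathrm{FR}(Y)=\{1\le r\le\infty:\ell_r\text{ is finitely representable in }Y\}$. Asymptotic structure: for $x=\sum_i c_ie_i\in X$, $\operatorname{supp}x=\{i:c_i\ne0\}$, and $x>m$ means $\operatorname{supp}x\subset[m+1,\infty)$. A basis $(b_i)_{i=1}^n$ of unit vectors of an $n$-dimensional normed space belongs to $\{X,(e_i)\}_n$ if for every $\varepsilon>0$: $\forall m_1\,\exists x_1>m_1\ \forall m_2\,\exists x_2>m_2\ \dots\ \forall m_n\,\exists x_n>m_n$ (with $x_i\in X$) such that there exist $0<c\le C$ with $C/c<1+\varepsilon$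 and $c\|\sum_{i=1}^n a_ib_i\|\le\|\sum_{i=1}^n a_ix_i\|\le C\|\sum_{i=1}^n a_ib_i\|$ for all scalars $(a_i)_{i=1}^n$. *)

theory Defs
  imports "HOL-Analysis.Analysis" "HOL-Library.Function_Algebras"
begin

text \<open>
  The scalar field is a type of sort \<open>{real_normed_field, heine_borel}\<close>. Both \<open>real\<close> and
  \<open>complex\<close> are of this sort, and by the Gelfand--Mazur theorem every such type is isometrically
  isomorphic to one of the two, so this sort says exactly ``real or complex scalars''.

  All families that are numbered from 1 in the usual notation are numbered from 0 here.
\<close>

definition infinite_dimensional ::
    "('k::field \<Rightarrow> 'v::ab_group_add \<Rightarrow> 'v) \<Rightarrow> 'v set \<Rightarrow> bool" where
  "infinite_dimensional sc V \<longleftrightarrow> \<not> (\<exists>B. finite B \<and> V \<subseteq> module.span sc B)"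

text \<open>
  The class \<open>banach\<close> provides the norm, its completeness and the underlying real structure of the
  space; \<open>sc\<close> is the multiplication by the actual (real or complex) scalars.
\<close>

locale banach_space_over = vector_space sc
  for sc :: "'k::{real_normed_field, heine_borel} \<Rightarrow> 'x::banach \<Rightarrow> 'x" +
  assumes norm_sc: "norm (sc c x) = norm c * norm x"
    and sc_of_real: "sc (of_real t) x = t *\<^sub>R x"
    and infinite_dim: "infinite_dimensional sc UNIV"

definition banach_subspace ::
    "('k::{real_normed_field, heine_borel} \<Rightarrow> 'x::banach \<Rightarrow> 'x) \<Rightarrow> 'x set \<Rightarrow> bool" where
  "banach_subspace sc Y \<longleftrightarrow>
     module.subspace sc Y \<and> closed Y \<and> infinite_dimensional sc Y"

definition linear_map_on ::
    "('k::field \<Rightarrow> 'v::ab_group_add \<Rightarrow> 'v) \<Rightarrow> ('k \<Rightarrow> 'w::ab_group_add \<Rightarrow> 'w) \<Rightarrow>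
     'v set \<Rightarrow> ('v \<Rightarrow> 'w) \<Rightarrow> bool" where
  "linear_map_on s1 s2 V T \<longleftrightarrow>
     (\<forall>x\<in>V. \<forall>y\<in>V. T (x + y) = T x + T y) \<and> (\<forall>c. \<forall>x\<in>V. T (s1 c x) = s2 c (T x))"

definition surj_linear_isometry ::
    "('k::field \<Rightarrow> 'x::real_normed_vector \<Rightarrow> 'x) \<Rightarrow> 'x set \<Rightarrow> ('x \<Rightarrow> 'x) \<Rightarrow> bool" where
  "surj_linear_isometry sc Y T \<longleftrightarrow>
     linear_map_on sc sc Y T \<and> T ` Y = Y \<and> (\<forall>y\<in>Y. norm (T y) = norm y)"

definition almost_transitive ::
    "('k::field \<Rightarrow> 'x::real_normed_vector \<Rightarrow> 'x) \<Rightarrow> 'x set \<Rightarrow> bool" where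
  "almost_transitive sc Y \<longleftrightarrow>
     (\<forall>y\<in>Y. norm y = 1 \<longrightarrow>
        {z\<in>Y. norm z = 1} \<subseteq> closure {T y |T. surj_linear_isometry sc Y T})"

definition normed_space_on ::
    "('k::real_normed_field \<Rightarrow> 'v::ab_group_add \<Rightarrow> 'v) \<Rightarrow> 'v set \<Rightarrow> ('v \<Rightarrow> real) \<Rightarrow> bool" where
  "normed_space_on s V N \<longleftrightarrow>
     vector_space s \<and> module.subspace s V \<and>
     (\<forall>x\<in>V. 0 \<le> N x \<and> (N x = 0 \<longleftrightarrow> x = 0)) \<and>
     (\<forall>c. \<forall>x\<in>V. N (s c x) = norm c * N x) \<and>
     (\<forall>x\<in>V. \<forall>y\<in>V. N (x + y) \<le> N x + N y)"

definition finitely_representable ::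
    "('k::real_normed_field \<Rightarrow> 'v::ab_group_add \<Rightarrow> 'v) \<Rightarrow> 'v set \<Rightarrow> ('v \<Rightarrow> real) \<Rightarrow>
     ('k \<Rightarrow> 'w::ab_group_add \<Rightarrow> 'w) \<Rightarrow> 'w set \<Rightarrow> ('w \<Rightarrow> real) \<Rightarrow> bool" where
  "finitely_representable s1 V1 N1 s2 V2 N2 \<longleftrightarrow>
     (\<forall>E. module.subspace s1 E \<and> E \<subseteq> V1 \<and> \<not> infinite_dimensional s1 E \<longrightarrow>
        (\<forall>\<epsilon>>0. \<exists>T. linear_map_on s1 s2 E T \<and> T ` E \<subseteq> V2 \<and>
           (\<exists>c C. 0 < c \<and> c \<le> C \<and> C / c < 1 + \<epsilon> \<and>
              (\<forall>x\<in>E. c * N1 x \<le> N2 (T x) \<and> N2 (T x) \<le> C * N1 x))))"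

definition seq_sc :: "'k::field \<Rightarrow> (nat \<Rightarrow> 'k) \<Rightarrow> nat \<Rightarrow> 'k" where
  "seq_sc c f = (\<lambda>i. c * f i)"

definition ell :: "ereal \<Rightarrow> (nat \<Rightarrow> 'k::real_normed_field) set" where
  "ell r = (if r = \<infinity> then {f. bounded (range f)}
            else {f. summable (\<lambda>i. norm (f i) powr real_of_ereal r)})"

definition ell_norm :: "ereal \<Rightarrow> (nat \<Rightarrow> 'k::real_normed_field) \<Rightarrow> real" where
  "ell_norm r f = (if r = \<infinity> then (SUP i. norm (f i))
     else (\<Sum>i. norm (f i) powr real_of_ereal r) powr (1 / real_of_ereal r))"

text \<open>With the norm \<open>ell_norm r\<close>, the following is the space $\ell_r^n$.\<close>

definition ell_fin :: "nat \<Rightarrow> (nat \<Rightarrow> 'k::real_normed_field) set" where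
  "ell_fin n = {f. \<forall>i\<ge>n. f i = 0}"

definition unit_seq :: "nat \<Rightarrow> nat \<Rightarrow> 'k::real_normed_field" where
  "unit_seq i = (\<lambda>j. if j = i then 1 else 0)"

definition FR :: "('k::real_normed_field \<Rightarrow> 'x::real_normed_vector \<Rightarrow> 'x) \<Rightarrow> 'x set \<Rightarrow> ereal set" where
  "FR sc Y =
     {r. 1 \<le> r \<and> finitely_representable seq_sc (ell r) (ell_norm r) sc Y norm}"

definition normalized_schauder_basis ::
    "('k::real_normed_field \<Rightarrow> 'x::real_normed_vector \<Rightarrow> 'x) \<Rightarrow> (nat \<Rightarrow> 'x) \<Rightarrow> bool" where
  "normalized_schauder_basis sc e \<longleftrightarrow>
     (\<forall>x. \<exists>!c. (\<lambda>i. sc (c i) (e i)) sums x) \<and> (\<forall>i. norm (e i) = 1)"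

definition basis_coeff ::
    "('k::real_normed_field \<Rightarrow> 'x::real_normed_vector \<Rightarrow> 'x) \<Rightarrow> (nat \<Rightarrow> 'x) \<Rightarrow> 'x \<Rightarrow> nat \<Rightarrow> 'k" where
  "basis_coeff sc e x = (THE c. (\<lambda>i. sc (c i) (e i)) sums x)"

definition basis_supp ::
    "('k::real_normed_field \<Rightarrow> 'x::real_normed_vector \<Rightarrow> 'x) \<Rightarrow> (nat \<Rightarrow> 'x) \<Rightarrow> 'x \<Rightarrow> nat set" where
  "basis_supp sc e x = {i. basis_coeff sc e x i \<noteq> 0}"

text \<open>
  The relation $x > m$, i.e. the coefficients of $x$ at the first $m$ basis vectors vanish. As the
  basis starts with \<open>e 0\<close>, the index set $[m+1,\infty)$ becomes \<open>{m..}\<close>.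
\<close>

definition supp_beyond ::
    "('k::real_normed_field \<Rightarrow> 'x::real_normed_vector \<Rightarrow> 'x) \<Rightarrow> (nat \<Rightarrow> 'x) \<Rightarrow> nat \<Rightarrow> 'x \<Rightarrow> bool" where
  "supp_beyond sc e m x \<longleftrightarrow> basis_supp sc e x \<subseteq> {m..}"

text \<open>
  \<open>asymptotic_game sc e \<Phi> n []\<close> unfolds to
  $\forall m_1\,\exists x_1>m_1\,\dots\,\forall m_n\,\exists x_n>m_n.\ \Phi\,[x_1,\dots,x_n]$;
  the list argument holds the vectors chosen so far.
\<close>

primrec asymptotic_game ::
    "('k::real_normed_field \<Rightarrow> 'x::real_normed_vector \<Rightarrow> 'x) \<Rightarrow> (nat \<Rightarrow> 'x) \<Rightarrow>
     ('x list \<Rightarrow> bool) \<Rightarrow> nat \<Rightarrow> 'x list \<Rightarrow> bool" where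
  "asymptotic_game sc e \<Phi> 0 xs = \<Phi> xs"
| "asymptotic_game sc e \<Phi> (Suc k) xs =
     (\<forall>m. \<exists>x. supp_beyond sc e m x \<and> asymptotic_game sc e \<Phi> k (xs @ [x]))"

definition unit_vector_basis_of ::
    "('k::real_normed_field \<Rightarrow> 'v::ab_group_add \<Rightarrow> 'v) \<Rightarrow> nat \<Rightarrow> 'v set \<Rightarrow> ('v \<Rightarrow> real) \<Rightarrow>
     (nat \<Rightarrow> 'v) \<Rightarrow> bool" where
  "unit_vector_basis_of s n V N b \<longleftrightarrow>
     inj_on b {..<n} \<and> \<not> module.dependent s (b ` {..<n}) \<and>
     module.span s (b ` {..<n}) = V \<and> (\<forall>i<n. N (b i) = 1)"

text \<open>
  The asymptotic structure $\{X,(e_i)\}_n$. A member is given as an $n$-dimensional space \<open>V\<close> with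
  norm \<open>N\<close> together with a basis \<open>b 0, \<dots>, b (n - 1)\<close> of \<open>V\<close>. The ambient space of \<open>V\<close>, with scalar
  multiplication \<open>s\<close>, is only there to host \<open>V\<close>; any $n$-dimensional normed space can be
  hosted by the space of all scalar sequences.
\<close>

definition asymptotic_structure ::
    "('k::real_normed_field \<Rightarrow> 'x::real_normed_vector \<Rightarrow> 'x) \<Rightarrow> (nat \<Rightarrow> 'x) \<Rightarrow> nat \<Rightarrow>
     ('k \<Rightarrow> 'v::ab_group_add \<Rightarrow> 'v) \<Rightarrow> ('v set \<times> ('v \<Rightarrow> real) \<times> (nat \<Rightarrow> 'v)) set" where
  "asymptotic_structure sc e n s =
     {(V, N, b). normed_space_on s V N \<and> unit_vector_basis_of s n V N b \<and>
        (\<forall>\<epsilon>>0. asymptotic_game sc e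
           (\<lambda>x. \<exists>c C. 0 < c \<and> c \<le> C \<and> C / c < 1 + \<epsilon> \<and>
              (\<forall>a. c * N (\<Sum>i<n. s (a i) (b i)) \<le> norm (\<Sum>i<n. sc (a i) (x ! i)) \<and>
                   norm (\<Sum>i<n. sc (a i) (x ! i)) \<le> C * N (\<Sum>i<n. s (a i) (b i))))
           n [])}"

end

theory Submission
  imports Defs
begin

text \<open>
  In the game, let \<open>y\<close> be the combination of the vectors of \<open>Y\<close> chosen so far. An almost isometric copy of
  $\ell_r^D$ in \<open>Y\<close> can be moved by an isometry of \<open>Y\<close> so that its first basis vector is almost
  $y/\|y\|$. In the span of any $m + 1$ of the other basis vectors there is a unit vector whose first
  \<open>m\<close> coefficients vanish; adding its multiples to \<open>y\<close> produces almost the $\ell_r$-norm. Of many such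
  vectors with disjoint blocks, one is far from the span of the vectors chosen before, which keeps the outcomes
  uniformly independent without any use of the basis constant. The norms that the outcomes induce on
  the scalar sequences then have a cluster point (Tychonoff), in which the approximate equations
  become exact.
\<close>

section \<open>Scalar sequences and sequence norms\<close>

text \<open>The isometry that moves the copy of l_r depends on the vector \<open>y\<close> built so
  far, hence on the prescribed scalars \<open>a\<close>. An outcome of the game is therefore
  controlled only along these particular combinations, and the rest of the norm is left open; this
  is why it has to be produced by compactness rather than written down. In dimension 2, homogeneity
  recovers every vector from one line of combinations, so there the whole norm is known. The limit
  must be positive definite, and convergence must be uniform over all coefficient vectors relative
  to the size of the norm. Both come from a lower bound for combinations that is the same for all
  outcomes: each vector has distance at least 1/4 from the span of its predecessors. Tail vectors
  are found by solving finitely many linear equations, so the basis coefficients enter only through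
  their algebraic linearity. Putting the next prescribed scalar into the one-step identity advances
  it by one stage, which yields the l_r formula for every \<open>k\<close> by induction.\<close>

lemma vector_space_seq_sc: "vector_space (seq_sc :: 'k::field \<Rightarrow> (nat \<Rightarrow> 'k) \<Rightarrow> nat \<Rightarrow> 'k)"
  by unfold_locales (auto simp: seq_sc_def algebra_simps fun_eq_iff)

interpretation seq: vector_space "seq_sc :: 'k::field \<Rightarrow> (nat \<Rightarrow> 'k) \<Rightarrow> nat \<Rightarrow> 'k"
  by (rule vector_space_seq_sc)

lemma sum_fun_apply: "(\<Sum>i\<in>A. f i) x = (\<Sum>i\<in>A. f i x)"
  by (induction A rule: infinite_finite_induct) auto

lemma seq_sc_apply [simp]: "seq_sc c f i = c * f i"
  by (simp add: seq_sc_def)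

lemma unit_seq_apply [simp]: "unit_seq i j = (if j = i then 1 else 0)"
  by (simp add: unit_seq_def)

lemma sum_unit_seq_apply:
  assumes "finite J"
  shows "(\<Sum>j\<in>J. seq_sc (c j) (unit_seq j)) i = (if i \<in> J then c i else 0)"
  using assms by (simp add: sum_fun_apply if_distrib cong: if_cong)

lemma subspace_ell_fin: "seq.subspace (ell_fin n :: (nat \<Rightarrow> 'k::real_normed_field) set)"
  by (rule seq.subspaceI) (auto simp: ell_fin_def)

lemma ell_fin_expand:
  assumes "f \<in> ell_fin n"
  shows "f = (\<Sum>i<n. seq_sc (f i) (unit_seq i))"
  using assms by (auto simp: fun_eq_iff sum_unit_seq_apply ell_fin_def)

lemma span_unit_seq: "seq.span (unit_seq ` {..<n}) = (ell_fin n :: (nat \<Rightarrow> 'k::real_normed_field) set)"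
proof
  show "seq.span (unit_seq ` {..<n}) \<subseteq> (ell_fin n :: (nat \<Rightarrow> 'k) set)"
    by (rule seq.span_minimal[OF _ subspace_ell_fin]) (auto simp: ell_fin_def)
  show "(ell_fin n :: (nat \<Rightarrow> 'k) set) \<subseteq> seq.span (unit_seq ` {..<n})"
  proof
    fix f :: "nat \<Rightarrow> 'k" assume "f \<in> ell_fin n"
    then have f: "f = (\<Sum>i<n. seq_sc (f i) (unit_seq i))" by (rule ell_fin_expand)
    show "f \<in> seq.span (unit_seq ` {..<n})"
      by (subst f) (intro seq.span_sum seq.span_scale seq.span_base; simp)
  qed
qed

lemma inj_unit_seq: "inj (unit_seq :: nat \<Rightarrow> nat \<Rightarrow> 'k::real_normed_field)"
  by (rule injI, rule ccontr) (metis unit_seq_apply zero_neq_one)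

lemma independent_unit_seq:
  "seq.independent ((unit_seq :: nat \<Rightarrow> nat \<Rightarrow> 'k::real_normed_field) ` {..<n})"
proof -
  have "u v = 0" if "(\<Sum>v\<in>(unit_seq :: nat \<Rightarrow> nat \<Rightarrow> 'k) ` {..<n}. seq_sc (u v) v) = 0"
    and "v \<in> (unit_seq :: nat \<Rightarrow> nat \<Rightarrow> 'k) ` {..<n}" for u and v :: "nat \<Rightarrow> 'k"
  proof -
    from that(2) obtain i where i: "i < n" "v = unit_seq i" by auto
    have "(\<Sum>j<n. seq_sc (u (unit_seq j)) (unit_seq j :: nat \<Rightarrow> 'k)) = 0"
      using that(1) by (subst (asm) sum.reindex) (auto intro: inj_on_subset[OF inj_unit_seq])
    then have "(\<Sum>j<n. seq_sc (u (unit_seq j)) (unit_seq j :: nat \<Rightarrow> 'k)) i = 0" by simp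
    then show ?thesis using i by (subst (asm) sum_unit_seq_apply) auto
  qed
  then show ?thesis by (subst seq.dependent_finite) auto
qed

text \<open>The l_r norm of the plane at \<open>(s, t)\<close>. It keeps most of the case
  distinction on \<open>r = \<infinity>\<close> inside this section: the estimates in the game and
  in the limit use its monotonicity, homogeneity and continuity.\<close>

definition ell2 :: "ereal \<Rightarrow> real \<Rightarrow> real \<Rightarrow> real" where
  "ell2 r s t = (if r = \<infinity> then max s t
     else (s powr real_of_ereal r + t powr real_of_ereal r) powr (1 / real_of_ereal r))"

lemma real_of_ereal_ge_1: "1 \<le> r \<Longrightarrow> r \<noteq> \<infinity> \<Longrightarrow> 1 \<le> real_of_ereal r"
  by (cases r) auto

lemma ell2_mono:
  assumes "1 \<le> r" "0 \<le> s" "s \<le> s'" "0 \<le> t" "t \<le> t'"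
  shows "ell2 r s t \<le> ell2 r s' t'"
  using assms real_of_ereal_ge_1[of r]
  by (auto simp: ell2_def intro!: powr_mono2 add_mono)

lemma ell2_scale:
  assumes "1 \<le> r" "0 \<le> c" "0 \<le> s" "0 \<le> t"
  shows "ell2 r (c * s) (c * t) = c * ell2 r s t"
proof (cases "r = \<infinity>")
  case True
  then show ?thesis using assms by (simp add: ell2_def max_mult_distrib_left)
next
  case False
  then have p: "1 \<le> real_of_ereal r" using assms real_of_ereal_ge_1 by blast
  have "ell2 r (c * s) (c * t) =
      (c powr real_of_ereal r * (s powr real_of_ereal r + t powr real_of_ereal r)) powr (1 / real_of_ereal r)"
    using assms False by (simp add: ell2_def powr_mult distrib_left)
  also have "\<dots> = (c powr real_of_ereal r) powr (1 / real_of_ereal r) *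
      (s powr real_of_ereal r + t powr real_of_ereal r) powr (1 / real_of_ereal r)"
    by (rule powr_mult)
  finally show ?thesis using p assms False by (simp add: ell2_def powr_powr)
qed

lemma ell2_commute: "ell2 r s t = ell2 r t s"
  by (simp add: ell2_def max.commute add.commute)

lemma ell2_nonneg: "0 \<le> s \<Longrightarrow> 0 \<le> t \<Longrightarrow> 0 \<le> ell2 r s t"
  by (auto simp: ell2_def)

text \<open>The limit \<open>s\<close> may be 0, as in the first round, where \<open>y = 0\<close>.
  Continuity of \<open>powr\<close> at 0 needs a nonnegative base and a positive exponent.\<close>

lemma tendsto_ell2_left:
  assumes "1 \<le> r" "(f \<longlongrightarrow> s) F" "\<And>x. 0 \<le> f x"
  shows "((\<lambda>x. ell2 r (f x) t) \<longlongrightarrow> ell2 r s t) F"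
proof (cases "r = \<infinity>")
  case True
  then show ?thesis using assms by (auto simp: ell2_def intro!: tendsto_intros)
next
  case False
  then have "1 \<le> real_of_ereal r" using assms real_of_ereal_ge_1 by blast
  then show ?thesis using assms False
    by (auto simp: ell2_def intro!: tendsto_powr2 tendsto_intros)
qed

section \<open>The l_r norm on finitely supported sequences\<close>

lemma bdd_above_ell_fin:
  assumes "f \<in> ell_fin n"
  shows "bdd_above (range (\<lambda>i. norm (f i)))"
proof (rule bdd_above_mono[OF bdd_above_finite])
  show "range (\<lambda>i. norm (f i)) \<subseteq> insert 0 ((\<lambda>i. norm (f i)) ` {..<n})"
    using assms unfolding ell_fin_def by (auto simp: image_iff) (metis lessThan_iff not_le norm_zero)
qed auto

lemma ell_fin_subset_ell: "ell_fin n \<subseteq> ell r"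
proof
  fix f :: "nat \<Rightarrow> 'a" assume f: "f \<in> ell_fin n"
  have "bounded (range f)"
    using bdd_above_ell_fin[OF f] by (auto simp: bounded_iff bdd_above_def)
  moreover have "summable (\<lambda>i. norm (f i) powr real_of_ereal r)"
    by (rule summable_finite[of "{..<n}"]) (use f in \<open>auto simp: ell_fin_def\<close>)
  ultimately show "f \<in> ell r" by (auto simp: ell_def)
qed

lemma ell_norm_ell_fin:
  assumes "f \<in> ell_fin n" "r \<noteq> \<infinity>"
  shows "ell_norm r f = (\<Sum>i<n. norm (f i) powr real_of_ereal r) powr (1 / real_of_ereal r)"
proof -
  have "(\<Sum>i. norm (f i) powr real_of_ereal r) = (\<Sum>i<n. norm (f i) powr real_of_ereal r)"
    by (rule suminf_finite) (use assms in \<open>auto simp: ell_fin_def\<close>)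
  then show ?thesis using assms by (simp add: ell_norm_def)
qed

lemma ell_norm_mono:
  assumes "1 \<le> r" "f \<in> ell_fin n" "g \<in> ell_fin n" "\<And>i. norm (f i) \<le> norm (g i)"
  shows "ell_norm r f \<le> ell_norm r g"
proof (cases "r = \<infinity>")
  case True
  then show ?thesis using assms bdd_above_ell_fin[of g n]
    by (auto simp: ell_norm_def intro!: cSUP_mono)
next
  case False
  then have "1 \<le> real_of_ereal r" using assms real_of_ereal_ge_1 by blast
  then show ?thesis using assms False
    by (auto simp: ell_norm_ell_fin[of _ n] intro!: powr_mono2 sum_mono sum_nonneg)
qed

text \<open>Sums of powers, and likewise suprema, split over disjoint supports. This serves twice:
  for a block vector against the direction of \<open>y\<close>, and for the induction from the
  one-step identity to the full l_r norm.\<close>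

lemma ell_norm_add_unit:
  assumes "1 \<le> r" "f \<in> ell_fin n" "f j = 0" "j < n"
  shows "ell_norm r (seq_sc c (unit_seq j) + f) = ell2 r (norm c) (ell_norm r f)"
proof (cases "r = \<infinity>")
  case True
  let ?g = "seq_sc c (unit_seq j) + f"
  have g: "?g \<in> ell_fin n" using assms by (auto simp: ell_fin_def)
  have "(SUP i. norm (?g i)) \<le> max (norm c) (SUP i. norm (f i))"
  proof (rule cSUP_least)
    fix i
    show "norm (?g i) \<le> max (norm c) (SUP i. norm (f i))"
      using assms(3) cSUP_upper[OF UNIV_I bdd_above_ell_fin[OF assms(2)], of i]
      by (cases "i = j") auto
  qed auto
  moreover have "norm c \<le> (SUP i. norm (?g i))"
    using cSUP_upper[OF UNIV_I bdd_above_ell_fin[OF g], of j] assms(3) by simp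
  moreover have "(SUP i. norm (f i)) \<le> (SUP i. norm (?g i))"
  proof (rule cSUP_mono[OF _ bdd_above_ell_fin[OF g]])
    show "\<exists>m\<in>UNIV. norm (f i) \<le> norm (?g m)" for i
      using assms(3) by (intro bexI[of _ i]) auto
  qed auto
  ultimately show ?thesis using True by (simp add: ell_norm_def ell2_def)
next
  case False
  then have p: "1 \<le> real_of_ereal r" using assms real_of_ereal_ge_1 by blast
  let ?p = "real_of_ereal r"
  let ?g = "seq_sc c (unit_seq j) + f"
  have g: "?g \<in> ell_fin n" using assms by (auto simp: ell_fin_def)
  have "(\<Sum>i<n. norm (?g i) powr ?p) = (\<Sum>i<n. (if i = j then norm c powr ?p else 0) + norm (f i) powr ?p)"
    using assms(3) by (intro sum.cong) auto
  also have "\<dots> = norm c powr ?p + (\<Sum>i<n. norm (f i) powr ?p)"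
    using assms(4) by (simp add: sum.distrib)
  also have "(\<Sum>i<n. norm (f i) powr ?p) = ell_norm r f powr ?p"
    using p False assms(2) by (simp add: ell_norm_ell_fin[of _ n] powr_powr sum_nonneg)
  finally show ?thesis using False g by (simp add: ell_norm_ell_fin[of _ n] ell2_def)
qed

lemma ell_norm_zero: "ell_norm r (0 :: nat \<Rightarrow> 'k::real_normed_field) = 0"
  by (simp add: ell_norm_def)

lemma ell_norm_unit: "1 \<le> r \<Longrightarrow> ell_norm r (seq_sc c (unit_seq j)) = norm c"
  using ell_norm_add_unit[of r 0 "Suc j" j c] real_of_ereal_ge_1[of r]
  by (auto simp: ell_fin_def ell_norm_zero ell2_def powr_powr)

lemma norm_le_ell_norm:
  assumes "1 \<le> r" "f \<in> ell_fin n"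
  shows "norm (f i) \<le> ell_norm r f"
proof (cases "i < n")
  case True
  have "ell_norm r (seq_sc (f i) (unit_seq i)) \<le> ell_norm r f"
    using assms True by (intro ell_norm_mono[of _ _ n]) (auto simp: ell_fin_def)
  then show ?thesis using ell_norm_unit[OF assms(1), of "f i" i] by simp
next
  case False
  then have "f i = 0" using assms by (auto simp: ell_fin_def)
  moreover have "0 \<le> ell_norm r f"
    using ell_norm_mono[OF assms(1), of 0 n f] assms(2) by (auto simp: ell_norm_zero ell_fin_def)
  ultimately show ?thesis by simp
qed

lemma ell_norm_nonneg: "1 \<le> r \<Longrightarrow> f \<in> ell_fin n \<Longrightarrow> 0 \<le> ell_norm r f"
  using norm_le_ell_norm norm_ge_zero order_trans by blast

lemma ell_norm_scale:
  assumes "1 \<le> r" "f \<in> ell_fin n"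
  shows "ell_norm r (seq_sc c f) = norm c * ell_norm r f"
proof (cases "r = \<infinity>")
  case True
  show ?thesis
  proof (rule antisym)
    show "ell_norm r (seq_sc c f) \<le> norm c * ell_norm r f"
      using True norm_le_ell_norm[OF assms]
      by (simp add: ell_norm_def[of _ "seq_sc c f"] norm_mult) (rule cSUP_least, auto intro: mult_left_mono)
    have "norm (f i) \<le> ell_norm r (seq_sc c f) / norm c" if "c \<noteq> 0" for i
      using norm_le_ell_norm[OF assms(1), of "seq_sc c f" n i] assms(2) that
      by (auto simp: ell_fin_def norm_mult field_simps)
    then have "ell_norm r f \<le> ell_norm r (seq_sc c f) / norm c" if "c \<noteq> 0"
      using that True by (subst ell_norm_def) (auto intro!: cSUP_least)
    then show "norm c * ell_norm r f \<le> ell_norm r (seq_sc c f)"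
      by (cases "c = 0") (auto simp: field_simps ell_norm_zero)
  qed
next
  case False
  then have p: "1 \<le> real_of_ereal r" using assms real_of_ereal_ge_1 by blast
  have "seq_sc c f \<in> ell_fin n" using assms by (auto simp: ell_fin_def)
  then show ?thesis using assms False p
    by (simp add: ell_norm_ell_fin[of _ n] norm_mult powr_mult powr_powr sum_nonneg
        flip: sum_distrib_left)
qed

section \<open>Finite nets of scalars and homogeneous linear systems\<close>

lemma finite_net_cball:
  fixes M \<eta> :: real
  assumes "\<eta> > 0"
  obtains S :: "'k::{real_normed_vector, heine_borel} set"
  where "finite S" "\<And>c. norm c \<le> M \<Longrightarrow> \<exists>s\<in>S. norm (c - s) < \<eta>"
proof -
  have "seq_compact (cball (0::'k) M)" by (simp add: compact_imp_seq_compact)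
  from seq_compact_imp_totally_bounded[OF this] assms
  obtain S where "finite S" "cball (0::'k) M \<subseteq> (\<Union>x\<in>S. ball x \<eta>)" by blast
  then show ?thesis
    by (intro that[of S]) (auto simp: subset_eq dist_norm norm_minus_commute)
qed

text \<open>Gaussian elimination: the last equation is solved for a pivot unknown \<open>p\<close>
  and substituted into the others. In the game, the equations ask that the first \<open>m\<close>
  basis coefficients of a combination vanish.\<close>

lemma homogeneous_system_nontrivial:
  fixes g :: "nat \<Rightarrow> 'i \<Rightarrow> 'k::field"
  assumes "finite J" "m < card J"
  shows "\<exists>d. (\<exists>j\<in>J. d j \<noteq> 0) \<and> (\<forall>i<m. (\<Sum>j\<in>J. d j * g i j) = 0)"
  using assms
proof (induction m arbitrary: J g)
  case 0
  then obtain j where "j \<in> J" by fastforce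
  then show ?case by (intro exI[of _ "\<lambda>_. 1"]) auto
next
  case (Suc m)
  show ?case
  proof (cases "\<forall>j\<in>J. g m j = 0")
    case True
    from Suc.IH[of J g] Suc.prems obtain d where "\<exists>j\<in>J. d j \<noteq> 0" "\<forall>i<m. (\<Sum>j\<in>J. d j * g i j) = 0"
      by auto
    with True show ?thesis by (intro exI[of _ d]) (auto simp: less_Suc_eq)
  next
    case False
    then obtain p where p: "p \<in> J" "g m p \<noteq> 0" by blast
    define J' where "J' = J - {p}"
    have J': "finite J'" "m < card J'" "J = insert p J'" "p \<notin> J'"
      using Suc.prems p by (auto simp: J'_def)
    from Suc.IH[OF J'(1,2), of "\<lambda>i j. g i j - g i p * g m j / g m p"] obtain d where
      d: "\<exists>j\<in>J'. d j \<noteq> 0" "\<forall>i<m. (\<Sum>j\<in>J'. d j * (g i j - g i p * g m j / g m p)) = 0" by blast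
    \<comment> \<open>The value of the pivot unknown that equation \<open>m\<close> forces.\<close>
    define q where "q = - (\<Sum>j\<in>J'. d j * g m j) / g m p"
    have sum_eq: "(\<Sum>j\<in>J. (d(p := q)) j * g i j) = q * g i p + (\<Sum>j\<in>J'. d j * g i j)" for i
    proof -
      have "(\<Sum>j\<in>J'. (d(p := q)) j * g i j) = (\<Sum>j\<in>J'. d j * g i j)"
        using J'(4) by (intro sum.cong) auto
      then show ?thesis using J' by simp
    qed
    have "(\<Sum>j\<in>J. (d(p := q)) j * g i j) = 0" if "i < Suc m" for i
    proof (cases "i = m")
      case True
      then show ?thesis unfolding sum_eq using p by (simp add: q_def)
    next
      case False
      then have "(\<Sum>j\<in>J'. d j * (g i j - g i p * g m j / g m p)) = 0" using d that by simp
      also have "(\<Sum>j\<in>J'. d j * (g i j - g i p * g m j / g m p)) =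
          (\<Sum>j\<in>J'. d j * g i j) - (\<Sum>j\<in>J'. d j * g m j) * (g i p / g m p)"
        by (simp add: right_diff_distrib sum_subtractf sum_distrib_left sum_distrib_right sum_divide_distrib mult_ac)
      finally show ?thesis unfolding sum_eq using p by (simp add: q_def)
    qed
    moreover have "\<exists>j\<in>J. (d(p := q)) j \<noteq> 0" using d(1) J' by auto
    ultimately show ?thesis by blast
  qed
qed

section \<open>Vectors chosen by almost transitivity\<close>

lemma linear_map_on_add:
  "linear_map_on s1 s2 V T \<Longrightarrow> x \<in> V \<Longrightarrow> y \<in> V \<Longrightarrow> T (x + y) = T x + T y"
  by (simp add: linear_map_on_def)

lemma linear_map_on_scale:
  "linear_map_on s1 s2 V T \<Longrightarrow> x \<in> V \<Longrightarrow> T (s1 c x) = s2 c (T x)"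
  by (simp add: linear_map_on_def)

context banach_space_over
begin

lemma bounded_linear_sc: "bounded_linear (sc c)"
proof (rule bounded_linear_intro[where K = "norm c"])
  show "sc c (t *\<^sub>R x) = t *\<^sub>R sc c x" for t x
    by (simp add: mult.commute flip: sc_of_real)
qed (auto simp: scale_right_distrib norm_sc)

lemma norm_scaled_unit: "x \<noteq> 0 \<Longrightarrow> norm (sc (of_real (1 / norm x)) x) = 1"
  by (simp add: norm_sc norm_divide)

section \<open>Algebraic linearity of the basis coefficients\<close>

lemma basis_coeff_sums:
  assumes "normalized_schauder_basis sc e"
  shows "(\<lambda>i. sc (basis_coeff sc e x i) (e i)) sums x"
  using assms theI'[of "\<lambda>c. (\<lambda>i. sc (c i) (e i)) sums x"]
  unfolding normalized_schauder_basis_def basis_coeff_def by blast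

lemma basis_coeff_eqI:
  assumes "normalized_schauder_basis sc e" "(\<lambda>i. sc (c i) (e i)) sums x"
  shows "basis_coeff sc e x = c"
  using assms basis_coeff_sums[OF assms(1), of x]
  unfolding normalized_schauder_basis_def by blast

lemma basis_coeff_add:
  assumes "normalized_schauder_basis sc e"
  shows "basis_coeff sc e (x + y) = (\<lambda>i. basis_coeff sc e x i + basis_coeff sc e y i)"
  using sums_add[OF basis_coeff_sums[OF assms, of x] basis_coeff_sums[OF assms, of y]]
  by (intro basis_coeff_eqI[OF assms]) (simp add: scale_left_distrib)

lemma basis_coeff_scale:
  assumes "normalized_schauder_basis sc e"
  shows "basis_coeff sc e (sc a x) = (\<lambda>i. a * basis_coeff sc e x i)"
  using bounded_linear.sums[OF bounded_linear_sc[of a] basis_coeff_sums[OF assms, of x]]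
  by (intro basis_coeff_eqI[OF assms]) simp

lemma basis_coeff_sum:
  assumes "normalized_schauder_basis sc e"
  shows "basis_coeff sc e (\<Sum>j\<in>J. sc (d j) (v j)) i = (\<Sum>j\<in>J. d j * basis_coeff sc e (v j) i)"
proof (induction J rule: infinite_finite_induct)
  case empty
  show ?case using basis_coeff_scale[OF assms, of 0 0] by simp
next
  case (infinite J)
  then show ?case using basis_coeff_scale[OF assms, of 0 0] by simp
qed (simp add: basis_coeff_add[OF assms] basis_coeff_scale[OF assms])

lemma linear_map_on_unit_sum:
  assumes "linear_map_on seq_sc sc (ell_fin n) T" "J \<subseteq> {..<n}"
  shows "T (\<Sum>j\<in>J. seq_sc (d j) (unit_seq j)) = (\<Sum>j\<in>J. sc (d j) (T (unit_seq j)))"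
proof -
  have "finite J" using assms(2) finite_subset by blast
  then show ?thesis using assms(2)
  proof (induction J)
    case empty
    have "0 \<in> ell_fin n" by (simp add: ell_fin_def)
    then have "T (seq_sc 0 0) = sc 0 (T 0)"
      using assms(1) unfolding linear_map_on_def by blast
    then show ?case unfolding sum.empty seq.scale_zero_left scale_zero_left .
  next
    case (insert j J)
    let ?s = "\<Sum>j\<in>J. seq_sc (d j) (unit_seq j)"
    have "?s \<in> ell_fin n" "unit_seq j \<in> ell_fin n" "seq_sc (d j) (unit_seq j) \<in> ell_fin n"
      using insert by (auto simp: ell_fin_def sum_unit_seq_apply)
    then have "T (seq_sc (d j) (unit_seq j) + ?s) = sc (d j) (T (unit_seq j)) + T ?s"
      using linear_map_on_add[OF assms(1)] linear_map_on_scale[OF assms(1)] by metis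
    then show ?case
      using insert.IH insert.prems unfolding sum.insert[OF insert.hyps] by (metis insert_subset)
  qed
qed

text \<open>Dividing by the last coefficient and using the distance 1/4 bounds that coefficient by 4
  times the norm. Removing the last term then enlarges the norm by a factor of at most 5, and the
  argument repeats. The resulting constant depends only on the number of vectors, so it is uniform
  over all outcomes of the game.\<close>

lemma coeff_le_norm_combination:
  fixes x :: "nat \<Rightarrow> 'x"
  assumes "\<And>j. j < k \<Longrightarrow> norm (x j) = 1"
    and "\<And>j c. j < k \<Longrightarrow> 1 / 4 \<le> norm ((\<Sum>i<j. sc (c i) (x i)) + x j)"
    and "i < k"
  shows "norm (c i) \<le> 4 * 5 ^ k * norm (\<Sum>i<k. sc (c i) (x i))"
  using assms
proof (induction k arbitrary: i)
  case 0
  then show ?case by simp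
next
  case (Suc k)
  let ?S = "\<Sum>i<k. sc (c i) (x i)"
  let ?S' = "\<Sum>i<Suc k. sc (c i) (x i)"
  have last: "norm (c k) \<le> 4 * norm ?S'"
  proof (cases "c k = 0")
    case False
    have "?S' = sc (c k) ((\<Sum>i<k. sc (c i / c k) (x i)) + x k)"
      using False by (simp add: scale_right_distrib scale_sum_right)
    moreover have "1 / 4 \<le> norm ((\<Sum>i<k. sc (c i / c k) (x i)) + x k)"
      using Suc.prems(2)[of k "\<lambda>i. c i / c k"] by simp
    then have "norm (c k) * (1 / 4) \<le> norm (c k) * norm ((\<Sum>i<k. sc (c i / c k) (x i)) + x k)"
      by (rule mult_left_mono) simp
    ultimately show ?thesis by (simp add: norm_sc)
  qed simp
  show ?case
  proof (cases "i = k")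
    case True
    have "4 * norm ?S' \<le> 4 * 5 ^ Suc k * norm ?S'"
      by (rule mult_right_mono) (use one_le_power[of "5::real" "Suc k"] in simp_all)
    with last True show ?thesis by simp
  next
    case False
    then have "norm (c i) \<le> 4 * 5 ^ k * norm ?S"
      using Suc.prems by (intro Suc.IH) auto
    also have "norm ?S = norm (?S' - sc (c k) (x k))" by simp
    also have "\<dots> \<le> norm ?S' + norm (c k)"
      using norm_triangle_ineq4[of ?S' "sc (c k) (x k)"] Suc.prems(1)[of k] by (simp add: norm_sc)
    also have "\<dots> \<le> 5 * norm ?S'" using last by simp
    finally show ?thesis by simp
  qed
qed

text \<open>
  A separated family that is large compared with a net of the ball of \<open>span {x 0, \<dots>, x (k - 1)}\<close>
  contains a vector far from this span: this replaces the use of the basis constant.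
\<close>

lemma separated_family_far_from_span:
  fixes x :: "nat \<Rightarrow> 'x"
  assumes x1: "\<And>j. j < k \<Longrightarrow> norm (x j) = 1"
    and x2: "\<And>j c. j < k \<Longrightarrow> 1 / 4 \<le> norm ((\<Sum>i<j. sc (c i) (x i)) + x j)"
  obtains p :: nat where
    "\<And>z. (\<And>j. j \<le> p \<Longrightarrow> norm (z j) = 1) \<Longrightarrow>
       (\<And>i j. i \<le> p \<Longrightarrow> j \<le> p \<Longrightarrow> i \<noteq> j \<Longrightarrow> 3 / 4 \<le> norm (z i - z j)) \<Longrightarrow>
       \<exists>j\<le>p. \<forall>c. 1 / 4 \<le> norm ((\<Sum>i<k. sc (c i) (x i)) + z j)"
proof -
  \<comment> \<open>Coefficient vectors in the same cell of the net differ by at most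
    \<open>2 * \<eta>\<close> in each coordinate, which contributes at most
    \<open>2 * k * \<eta> \<le> 1 / 4\<close> to a norm. Together with two distances below 1/4 this
    stays under the separation 3/4.\<close>
  define \<eta> :: real where "\<eta> = 1 / (8 * (real k + 1))"
  \<comment> \<open>A combination within 1/4 of the negative of a unit vector has norm at most 5/4;
    the other factor is the constant of \<open>coeff_le_norm_combination\<close>.\<close>
  define M :: real where "M = 4 * 5 ^ k * (5 / 4)"
  have \<eta>: "\<eta> > 0" by (simp add: \<eta>_def)
  obtain S :: "'k set" where S: "finite S" "\<And>c. norm c \<le> M \<Longrightarrow> \<exists>s\<in>S. norm (c - s) < \<eta>"
    using finite_net_cball[OF \<eta>] by blast
  let ?P = "PiE {..<k} (\<lambda>_. S)"
  have finP: "finite ?P" using S by (intro finite_PiE) auto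
  show ?thesis
  proof (rule that[of "card ?P"], rule ccontr)
    fix z :: "nat \<Rightarrow> 'x"
    assume z1: "\<And>j. j \<le> card ?P \<Longrightarrow> norm (z j) = 1"
      and z2: "\<And>i j. i \<le> card ?P \<Longrightarrow> j \<le> card ?P \<Longrightarrow> i \<noteq> j \<Longrightarrow> 3 / 4 \<le> norm (z i - z j)"
      and "\<not> (\<exists>j\<le>card ?P. \<forall>c. 1 / 4 \<le> norm ((\<Sum>i<k. sc (c i) (x i)) + z j))"
    then have "\<forall>j. \<exists>c. j \<le> card ?P \<longrightarrow> norm ((\<Sum>i<k. sc (c i) (x i)) + z j) < 1 / 4"
      by (meson not_le)
    then obtain c where c: "\<And>j. j \<le> card ?P \<Longrightarrow> norm ((\<Sum>i<k. sc (c j i) (x i)) + z j) < 1 / 4"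
      by metis
    have cM: "norm (c j i) \<le> M" if "j \<le> card ?P" "i < k" for i j
    proof -
      have "norm (\<Sum>i<k. sc (c j i) (x i)) \<le> 5 / 4"
        using c[OF that(1)] z1[OF that(1)]
          norm_triangle_ineq4[of "(\<Sum>i<k. sc (c j i) (x i)) + z j" "z j"] by simp
      then have "4 * 5 ^ k * norm (\<Sum>i<k. sc (c j i) (x i)) \<le> M"
        unfolding M_def by (intro mult_left_mono) auto
      then show ?thesis using coeff_le_norm_combination[OF x1 x2 that(2), of "c j"] by simp
    qed
    have "\<forall>j i. \<exists>s. j \<le> card ?P \<longrightarrow> i < k \<longrightarrow> s \<in> S \<and> norm (c j i - s) < \<eta>"
      using S(2) cM by meson
    then obtain s where s: "\<And>j i. j \<le> card ?P \<Longrightarrow> i < k \<Longrightarrow> s j i \<in> S \<and> norm (c j i - s j i) < \<eta>"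
      by metis
    \<comment> \<open>There are \<open>card ?P + 1\<close> indices for at most
      \<open>card ?P\<close> cells.\<close>
    have "card ((\<lambda>j. restrict (s j) {..<k}) ` {..card ?P}) \<le> card ?P"
      using s by (intro card_mono finP) (auto split: if_splits)
    then have "\<not> inj_on (\<lambda>j. restrict (s j) {..<k}) {..card ?P}"
      by (intro pigeonhole) simp
    then obtain i j where ij: "i \<le> card ?P" "j \<le> card ?P" "i \<noteq> j"
      "restrict (s i) {..<k} = restrict (s j) {..<k}"
      by (auto simp: inj_on_def)
    have diff: "norm (c i l - c j l) \<le> 2 * \<eta>" if "l < k" for l
    proof -
      have "s i l = s j l" using ij(4) that by (metis lessThan_iff restrict_apply')
      then have "norm (c i l - c j l) \<le> norm (c i l - s i l) + norm (c j l - s j l)"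
        using norm_triangle_ineq4[of "c i l - s i l" "c j l - s j l"] by simp
      then show ?thesis using s[OF ij(1) that] s[OF ij(2) that] by linarith
    qed
    let ?a = "(\<Sum>l<k. sc (c i l) (x l)) + z i" and ?b = "(\<Sum>l<k. sc (c j l) (x l)) + z j"
    let ?d = "\<Sum>l<k. sc (c i l - c j l) (x l)"
    have eq: "z i - z j = (?a - ?b) - ?d"
      by (simp add: scale_left_diff_distrib sum_subtractf)
    have "norm (z i - z j) \<le> norm ?a + norm ?b + norm ?d"
      unfolding eq using norm_triangle_ineq4[of "?a - ?b" ?d] norm_triangle_ineq4[of ?a ?b] by linarith
    also have "norm ?d \<le> (\<Sum>l<k. 2 * \<eta>)"
      using diff x1 by (intro sum_norm_le) (auto simp: norm_sc)
    also have "\<dots> \<le> 1 / 4"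
      by (simp add: \<eta>_def field_simps)
    finally show False using c[OF ij(1)] c[OF ij(2)] z2[OF ij(1-3)] by linarith
  qed
qed

text \<open>Finite representability controls only the ratio \<open>C / c\<close>. Dividing by
  \<open>c\<close> fixes the scale and puts all the distortion into the upper estimate.\<close>

lemma FR_embedding:
  assumes "banach_subspace sc Y" "r \<in> FR sc Y" "\<epsilon> > 0"
  obtains S where "linear_map_on seq_sc sc (ell_fin n) S" "S ` ell_fin n \<subseteq> Y"
    "\<And>f. f \<in> ell_fin n \<Longrightarrow> ell_norm r f \<le> norm (S f)"
    "\<And>f. f \<in> ell_fin n \<Longrightarrow> norm (S f) \<le> (1 + \<epsilon>) * ell_norm r f"
proof -
  have "\<not> infinite_dimensional seq_sc (ell_fin n :: (nat \<Rightarrow> 'k) set)"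
    unfolding infinite_dimensional_def using span_unit_seq[of n, where 'k = 'k]
    by (metis finite_imageI finite_lessThan order_refl)
  then have E: "seq.subspace (ell_fin n :: (nat \<Rightarrow> 'k) set) \<and> ell_fin n \<subseteq> ell r \<and>
      \<not> infinite_dimensional seq_sc (ell_fin n :: (nat \<Rightarrow> 'k) set)"
    using subspace_ell_fin ell_fin_subset_ell by blast
  have FR: "finitely_representable seq_sc (ell r) (ell_norm r) sc Y norm"
    using assms(2) by (simp add: FR_def)
  have "\<exists>T. linear_map_on seq_sc sc (ell_fin n) T \<and> T ` ell_fin n \<subseteq> Y \<and>
      (\<exists>c C. 0 < c \<and> c \<le> C \<and> C / c < 1 + \<epsilon> \<and>
        (\<forall>f\<in>ell_fin n. c * ell_norm r f \<le> norm (T f) \<and> norm (T f) \<le> C * ell_norm r f))"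
    by (rule FR[unfolded finitely_representable_def, THEN spec, THEN mp, OF E,
          THEN spec, THEN mp, OF assms(3)])
  then obtain T c C where T: "linear_map_on seq_sc sc (ell_fin n) T" "T ` ell_fin n \<subseteq> Y"
    and c: "0 < c" "c \<le> C" "C / c < 1 + \<epsilon>"
    and b: "\<And>f. f \<in> ell_fin n \<Longrightarrow> c * ell_norm r f \<le> norm (T f) \<and> norm (T f) \<le> C * ell_norm r f"
    by metis
  have r: "1 \<le> r" using assms(2) by (simp add: FR_def)
  let ?S = "\<lambda>f. sc (of_real (1 / c)) (T f)"
  have nS: "norm (?S f) = norm (T f) / c" for f
    using c by (simp add: norm_sc norm_divide)
  have "linear_map_on seq_sc sc (ell_fin n) ?S"
    using T(1) by (simp add: linear_map_on_def scale_right_distrib mult.commute)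
  moreover have "?S ` ell_fin n \<subseteq> Y"
    using T(2) assms(1) by (auto simp: banach_subspace_def intro!: subspace_scale)
  moreover have "ell_norm r f \<le> norm (?S f)" if "f \<in> ell_fin n" for f
    using b[OF that] c unfolding nS by (simp add: field_simps)
  moreover have "norm (?S f) \<le> (1 + \<epsilon>) * ell_norm r f" if "f \<in> ell_fin n" for f
  proof -
    have "norm (?S f) \<le> C / c * ell_norm r f"
      using b[OF that] c unfolding nS by (simp add: field_simps)
    also have "\<dots> \<le> (1 + \<epsilon>) * ell_norm r f"
      using c ell_norm_nonneg[OF r that] by (intro mult_right_mono) auto
    finally show ?thesis .
  qed
  ultimately show ?thesis by (rule that)
qed

text \<open>Almost transitivity brings the direction of the image of \<open>unit_seq 0\<close> close
  to the direction of \<open>y\<close>, and composing with an isometry of \<open>Y\<close> preserves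
  both norm estimates. The scalar in the last estimate gives the approximating multiple exactly the
  norm of \<open>y\<close>.\<close>

lemma FR_embedding_near:
  assumes "banach_subspace sc Y" "almost_transitive sc Y" "r \<in> FR sc Y" "\<epsilon> > 0" "\<eta> > 0"
    and "y \<in> Y" "n \<ge> 1"
  obtains R where "linear_map_on seq_sc sc (ell_fin n) R" "R ` ell_fin n \<subseteq> Y"
    "\<And>f. f \<in> ell_fin n \<Longrightarrow> ell_norm r f \<le> norm (R f)"
    "\<And>f. f \<in> ell_fin n \<Longrightarrow> norm (R f) \<le> (1 + \<epsilon>) * ell_norm r f"
    "norm (y - R (seq_sc (of_real (norm y / norm (R (unit_seq 0)))) (unit_seq 0))) \<le> \<eta>"
proof -
  obtain S where S: "linear_map_on seq_sc sc (ell_fin n) S" "S ` ell_fin n \<subseteq> Y"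
    "\<And>f. f \<in> ell_fin n \<Longrightarrow> ell_norm r f \<le> norm (S f)"
    "\<And>f. f \<in> ell_fin n \<Longrightarrow> norm (S f) \<le> (1 + \<epsilon>) * ell_norm r f"
    using FR_embedding[OF assms(1,3,4)] by blast
  have r: "1 \<le> r" using assms(3) by (simp add: FR_def)
  have e0: "unit_seq 0 \<in> (ell_fin n :: (nat \<Rightarrow> 'k) set)" using assms(7) by (auto simp: ell_fin_def)
  define u where "u = S (unit_seq 0)"
  have u: "u \<in> Y" using S(2) e0 by (auto simp: u_def)
  have "1 \<le> norm u" using S(3)[OF e0] ell_norm_unit[OF r, of "1 :: 'k" 0] by (simp add: u_def)
  then have u0: "u \<noteq> 0" by auto
  have Y: "subspace Y" using assms(1) by (simp add: banach_subspace_def)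
  have "\<exists>T. surj_linear_isometry sc Y T \<and> norm (y - sc (of_real (norm y / norm u)) (T u)) \<le> \<eta>"
  proof (cases "y = 0")
    \<comment> \<open>The situation before the first vector is chosen: there is no direction to hit,
      and the identity will do.\<close>
    case True
    have "surj_linear_isometry sc Y id" by (simp add: surj_linear_isometry_def linear_map_on_def)
    then show ?thesis using True assms(5) by auto
  next
    case False
    define u1 where "u1 = sc (of_real (1 / norm u)) u"
    define y1 where "y1 = sc (of_real (1 / norm y)) y"
    have "u1 \<in> Y" "norm u1 = 1" "y1 \<in> Y" "norm y1 = 1"
      using u u0 False assms(6) norm_scaled_unit subspace_scale[OF Y]
      by (simp_all add: u1_def y1_def del: of_real_divide)
    then have "y1 \<in> closure {T u1 |T. surj_linear_isometry sc Y T}"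
      using assms(2) unfolding almost_transitive_def by blast
    \<comment> \<open>Scaling back from the unit sphere multiplies the error by
      \<open>norm y\<close>.\<close>
    moreover have "\<eta> / norm y > 0" using assms(5) False by simp
    ultimately obtain T where T: "surj_linear_isometry sc Y T" "dist (T u1) y1 < \<eta> / norm y"
      unfolding closure_approachable by blast
    have "T u1 = sc (of_real (1 / norm u)) (T u)"
      using T(1) u unfolding u1_def surj_linear_isometry_def linear_map_on_def by blast
    then have "y - sc (of_real (norm y / norm u)) (T u) = sc (of_real (norm y)) (y1 - T u1)"
      using False by (simp add: y1_def scale_right_diff_distrib)
    then have "norm (y - sc (of_real (norm y / norm u)) (T u)) = norm y * dist (T u1) y1"
      by (simp add: norm_sc dist_norm norm_minus_commute)
    also have "\<dots> \<le> \<eta>" using T(2) False by (simp add: field_simps)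
    finally show ?thesis using T(1) by blast
  qed
  then obtain T where T: "surj_linear_isometry sc Y T"
    and Ty: "norm (y - sc (of_real (norm y / norm u)) (T u)) \<le> \<eta>" by blast
  let ?R = "\<lambda>f. T (S f)"
  have SY: "S f \<in> Y" if "f \<in> ell_fin n" for f using S(2) that by blast
  have lin: "linear_map_on seq_sc sc (ell_fin n) ?R"
    using S(1) T SY by (simp add: linear_map_on_def surj_linear_isometry_def)
  have nR: "norm (?R f) = norm (S f)" if "f \<in> ell_fin n" for f
    using T SY[OF that] by (simp add: surj_linear_isometry_def)
  have "?R ` ell_fin n \<subseteq> Y" using T SY by (auto simp: surj_linear_isometry_def)
  moreover have "norm (y - ?R (seq_sc (of_real (norm y / norm (?R (unit_seq 0)))) (unit_seq 0))) \<le> \<eta>"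
  proof -
    have "?R (seq_sc a (unit_seq 0)) = sc a (T u)" for a
      using linear_map_on_scale[OF lin e0] by (simp only: u_def)
    then show ?thesis using Ty nR[OF e0] by (simp add: u_def)
  qed
  ultimately show ?thesis using lin S(3,4) nR by (intro that[of ?R]) auto
qed

text \<open>More than \<open>m\<close> unknowns against \<open>m\<close> equations leave a
  nontrivial combination. The lower estimate for \<open>R\<close> keeps its image nonzero, so it can
  be normalized.\<close>

lemma block_vector:
  assumes "normalized_schauder_basis sc e" "linear_map_on seq_sc sc (ell_fin n) R"
    and "\<And>f. f \<in> ell_fin n \<Longrightarrow> ell_norm r f \<le> norm (R f)" "1 \<le> r"
    and "J \<subseteq> {..<n}" "m < card J"
  shows "\<exists>h\<in>ell_fin n. (\<forall>l. l \<notin> J \<longrightarrow> h l = 0) \<and> norm (R h) = 1 \<and> supp_beyond sc e m (R h)"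
proof -
  have J: "finite J" using assms(5) finite_subset by blast
  obtain d where d: "\<exists>j\<in>J. d j \<noteq> 0" "\<forall>i<m. (\<Sum>j\<in>J. d j * basis_coeff sc e (R (unit_seq j)) i) = 0"
    using homogeneous_system_nontrivial[OF J assms(6), of "\<lambda>i j. basis_coeff sc e (R (unit_seq j)) i"]
    by blast
  define f where "f = (\<Sum>j\<in>J. seq_sc (d j) (unit_seq j))"
  have fi: "f i = (if i \<in> J then d i else 0)" for i
    unfolding f_def by (rule sum_unit_seq_apply[OF J])
  have f: "f \<in> ell_fin n" using assms(5) by (auto simp: ell_fin_def fi)
  obtain j where "j \<in> J" "d j \<noteq> 0" using d by blast
  then have "0 < norm (R f)"
    using norm_le_ell_norm[OF assms(4) f, of j] assms(3)[OF f] by (simp add: fi) (metis less_le_trans zero_less_norm_iff)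
  then have Rf: "R f \<noteq> 0" by simp
  let ?a = "of_real (1 / norm (R f))"
  have Rh: "R (seq_sc ?a f) = sc ?a (R f)" using assms(2) f unfolding linear_map_on_def by blast
  have "basis_coeff sc e (R f) i = 0" if "i < m" for i
    unfolding f_def linear_map_on_unit_sum[OF assms(2,5)] basis_coeff_sum[OF assms(1)]
    using d that by blast
  then have "supp_beyond sc e m (R (seq_sc ?a f))"
    unfolding Rh supp_beyond_def basis_supp_def basis_coeff_scale[OF assms(1)]
    by (auto simp: not_less[symmetric])
  moreover have "norm (R (seq_sc ?a f)) = 1" unfolding Rh by (rule norm_scaled_unit[OF Rf])
  ultimately show ?thesis using f by (intro bexI[of _ "seq_sc ?a f"]) (auto simp: fi ell_fin_def)
qed

text \<open>One round of the game. The error has an additive part, because \<open>y\<close> is only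
  close to a multiple of the image of \<open>unit_seq 0\<close>, and a part proportional to the
  norm, from the distortion of the embedding. The number of candidate vectors depends only on the
  earlier moves, so the dimension can be fixed before the embedding is chosen.\<close>

lemma asymptotic_move:
  fixes x :: "nat \<Rightarrow> 'x"
  assumes basis: "normalized_schauder_basis sc e"
    and Y: "banach_subspace sc Y" "almost_transitive sc Y" "r \<in> FR sc Y"
    and x1: "\<And>j. j < k \<Longrightarrow> norm (x j) = 1"
    and x2: "\<And>j c. j < k \<Longrightarrow> 1 / 4 \<le> norm ((\<Sum>i<j. sc (c i) (x i)) + x j)"
    and y: "y \<in> Y" and \<eta>: "\<eta> > 0"
  shows "\<exists>z\<in>Y. norm z = 1 \<and> supp_beyond sc e m z \<and>
    (\<forall>c. 1 / 4 \<le> norm ((\<Sum>i<k. sc (c i) (x i)) + z)) \<and>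
    (\<forall>\<mu>. \<bar>norm (y + sc \<mu> z) - ell2 r (norm y) (norm \<mu>)\<bar> \<le> \<eta> * (1 + ell2 r (norm y) (norm \<mu>)))"
proof -
  have r: "1 \<le> r" using Y(3) by (simp add: FR_def)
  obtain p :: nat where p:
    "\<And>z. (\<And>j. j \<le> p \<Longrightarrow> norm (z j) = 1) \<Longrightarrow>
       (\<And>i j. i \<le> p \<Longrightarrow> j \<le> p \<Longrightarrow> i \<noteq> j \<Longrightarrow> 3 / 4 \<le> norm (z i - z j)) \<Longrightarrow>
       \<exists>j\<le>p. \<forall>c. 1 / 4 \<le> norm ((\<Sum>i<k. sc (c i) (x i)) + z j)"
    using separated_family_far_from_span[OF x1 x2] by blast
  \<comment> \<open>Coordinate 0 is reserved for the direction of \<open>y\<close>; the others form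
    \<open>p + 1\<close> blocks of \<open>m + 1\<close> coordinates, one more than the number of
    support conditions.\<close>
  define D where "D = 1 + Suc p * Suc m"
  define I where "I = (\<lambda>j. {1 + j * Suc m..<1 + Suc j * Suc m})"
  \<comment> \<open>The bound 1/3 gives \<open>1 / (1 + \<epsilon>) \<ge> 3 / 4\<close>, the
    separation required of the candidates.\<close>
  define \<epsilon> where "\<epsilon> = min \<eta> (1 / 3)"
  have \<epsilon>: "0 < \<epsilon>" "\<epsilon> \<le> \<eta>" "\<epsilon> \<le> 1 / 3" using \<eta> by (auto simp: \<epsilon>_def)
  have "1 \<le> D" by (simp add: D_def)
  then obtain R where R: "linear_map_on seq_sc sc (ell_fin D) R" "R ` ell_fin D \<subseteq> Y"
    and R1: "\<And>f. f \<in> ell_fin D \<Longrightarrow> ell_norm r f \<le> norm (R f)"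
    and R2: "\<And>f. f \<in> ell_fin D \<Longrightarrow> norm (R f) \<le> (1 + \<epsilon>) * ell_norm r f"
    and R3: "norm (y - R (seq_sc (of_real (norm y / norm (R (unit_seq 0)))) (unit_seq 0))) \<le> \<eta>"
    using FR_embedding_near[OF Y \<epsilon>(1) \<eta> y] by metis
  have IJ: "I j \<subseteq> {..<D}" if "j \<le> p" for j
  proof -
    have "Suc j * Suc m \<le> Suc p * Suc m" using that by (intro mult_le_mono1) simp
    then show ?thesis unfolding I_def D_def by force
  qed
  have disj: "l \<notin> I j" if "l \<in> I i" "i \<noteq> j" for i j l
  proof -
    have "I i \<inter> I j = {}" if "i < j" for i j
    proof -
      have "Suc i * Suc m \<le> j * Suc m" using that by (intro mult_le_mono1) simp
      then show ?thesis unfolding I_def by force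
    qed
    then show ?thesis using that by (metis disjoint_iff linorder_neqE_nat)
  qed
  have "\<forall>j. \<exists>h. j \<le> p \<longrightarrow> h \<in> ell_fin D \<and> (\<forall>l. l \<notin> I j \<longrightarrow> h l = 0) \<and> norm (R h) = 1 \<and>
      supp_beyond sc e m (R h)"
    using block_vector[OF basis R(1) R1 r IJ, of _ m] by (simp add: I_def) blast
  then obtain h where h: "\<And>j. j \<le> p \<Longrightarrow> h j \<in> ell_fin D" "\<And>j l. j \<le> p \<Longrightarrow> l \<notin> I j \<Longrightarrow> h j l = 0"
    "\<And>j. j \<le> p \<Longrightarrow> norm (R (h j)) = 1" "\<And>j. j \<le> p \<Longrightarrow> supp_beyond sc e m (R (h j))"
    by metis
  have hnorm: "1 \<le> (1 + \<epsilon>) * ell_norm r (h j)" if "j \<le> p" for j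
    using R2[OF h(1)[OF that]] h(3)[OF that] by simp
  have "3 / 4 \<le> norm (R (h i) - R (h j))" if ij: "i \<le> p" "j \<le> p" "i \<noteq> j" for i j
  proof -
    \<comment> \<open>The blocks are disjoint, so the difference agrees with \<open>h i\<close> on
      block \<open>i\<close> and its l_r norm is at least that of \<open>h i\<close>.\<close>
    let ?d = "h i + seq_sc (- 1) (h j)"
    have d: "seq_sc (- 1) (h j) \<in> ell_fin D" "?d \<in> ell_fin D"
      using h(1)[OF ij(1)] h(1)[OF ij(2)] by (auto simp: ell_fin_def)
    have "R ?d = R (h i) + sc (- 1) (R (h j))"
      using linear_map_on_add[OF R(1) h(1)[OF ij(1)] d(1)]
        linear_map_on_scale[OF R(1) h(1)[OF ij(2)], of "- 1"] by (simp only:)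
    then have "R ?d = R (h i) - R (h j)" by simp
    moreover have "ell_norm r (h i) \<le> ell_norm r ?d"
    proof (rule ell_norm_mono[OF r h(1)[OF ij(1)] d(2)])
      fix l
      show "norm (h i l) \<le> norm (?d l)"
        using h(2)[OF ij(1), of l] h(2)[OF ij(2), of l] disj[OF _ ij(3), of l] by (cases "l \<in> I i") auto
    qed
    moreover have "3 / 4 \<le> ell_norm r (h i)"
    proof (rule ccontr)
      assume "\<not> 3 / 4 \<le> ell_norm r (h i)"
      then have "(1 + \<epsilon>) * ell_norm r (h i) < (1 + \<epsilon>) * (3 / 4)"
        using \<epsilon> by (intro mult_strict_left_mono) auto
      then show False using hnorm[OF ij(1)] \<epsilon>(3) by simp
    qed
    ultimately show ?thesis using R1[OF d(2)] by simp
  qed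
  then obtain j where j: "j \<le> p" "\<And>c. 1 / 4 \<le> norm ((\<Sum>i<k. sc (c i) (x i)) + R (h j))"
    using p[of "\<lambda>j. R (h j)"] h(3) by blast
  \<comment> \<open>\<open>s\<close>, and \<open>l\<close> below, are the l_r norms of the
    preimages. They fall short of \<open>norm y\<close> and of 1, respectively, by a factor of at
    most \<open>1 + \<epsilon>\<close>.\<close>
  define s where "s = norm y / norm (R (unit_seq 0))"
  have e0: "unit_seq 0 \<in> (ell_fin D :: (nat \<Rightarrow> 'k) set)" by (auto simp: ell_fin_def D_def)
  have d: "1 \<le> norm (R (unit_seq 0))" "norm (R (unit_seq 0)) \<le> 1 + \<epsilon>"
    using R1[OF e0] R2[OF e0] ell_norm_unit[OF r, of "1 :: 'k" 0] by simp_all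
  then have s_eq: "norm y = s * norm (R (unit_seq 0))" and s0: "0 \<le> s" by (auto simp: s_def)
  have s: "0 \<le> s" "s \<le> norm y" "norm y \<le> (1 + \<epsilon>) * s"
    using mult_left_mono[OF d(1) s0] mult_left_mono[OF d(2) s0] s0 by (simp_all add: s_eq mult.commute)
  define l where "l = ell_norm r (h j)"
  have l: "0 \<le> l" "l \<le> 1" "1 \<le> (1 + \<epsilon>) * l"
    using R1[OF h(1)[OF j(1)]] h(3)[OF j(1)] hnorm[OF j(1)]
      ell_norm_nonneg[OF r h(1)[OF j(1)]]
    by (auto simp: l_def)
  have "\<bar>norm (y + sc \<mu> (R (h j))) - ell2 r (norm y) (norm \<mu>)\<bar> \<le> \<eta> * (1 + ell2 r (norm y) (norm \<mu>))"
    for \<mu>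
  proof -
    define L where "L = ell2 r (norm y) (norm \<mu>)"
    \<comment> \<open>The l_r norm of the preimage. Both \<open>L\<close> and the norm of its image
      lie between \<open>q\<close> and \<open>(1 + \<epsilon>) * q\<close>; exchanging the multiple
      of the first basis image for \<open>y\<close> costs a further \<open>\<eta>\<close>.\<close>
    define q where "q = ell2 r s (norm \<mu> * l)"
    have L0: "0 \<le> L" by (simp add: L_def ell2_nonneg)
    have "norm \<mu> * l \<le> norm \<mu>" using l mult_left_mono[of l 1 "norm \<mu>"] by simp
    then have qL: "q \<le> L" unfolding q_def L_def using s l by (intro ell2_mono[OF r]) auto
    have "norm \<mu> * 1 \<le> norm \<mu> * ((1 + \<epsilon>) * l)" by (intro mult_left_mono l) simp
    then have "L \<le> ell2 r ((1 + \<epsilon>) * s) ((1 + \<epsilon>) * (norm \<mu> * l))"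
      unfolding L_def using s by (intro ell2_mono[OF r]) (auto simp: mult_ac)
    also have "\<dots> = (1 + \<epsilon>) * q"
      unfolding q_def using s l \<epsilon> by (intro ell2_scale[OF r]) auto
    finally have Lq: "L \<le> q + \<epsilon> * q" by (simp add: algebra_simps)
    let ?v = "seq_sc (of_real s :: 'k) (unit_seq 0)" and ?w = "seq_sc \<mu> (h j)"
    have vw: "?v \<in> ell_fin D" "?w \<in> ell_fin D" "?v + ?w \<in> ell_fin D"
      by (intro seq.subspace_add[OF subspace_ell_fin] seq.subspace_scale[OF subspace_ell_fin]
          e0 h(1)[OF j(1)])+
    have "h j 0 = 0" by (rule h(2)[OF j(1)]) (simp add: I_def)
    then have "?w 0 = 0" by simp
    moreover have "0 < D" by (simp add: D_def)
    ultimately have "ell_norm r (?v + ?w) = ell2 r (norm (of_real s :: 'k)) (ell_norm r ?w)"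
      by (rule ell_norm_add_unit[OF r vw(2)])
    also have "\<dots> = q"
      unfolding ell_norm_scale[OF r h(1)[OF j(1)]] using s by (simp add: q_def l_def)
    finally have "ell_norm r (?v + ?w) = q" .
    then have Rvw: "q \<le> norm (R (?v + ?w))" "norm (R (?v + ?w)) \<le> q + \<epsilon> * q"
      using R1[OF vw(3)] R2[OF vw(3)] by (simp_all add: algebra_simps)
    have "R (?v + ?w) = R ?v + sc \<mu> (R (h j))"
      using linear_map_on_add[OF R(1) vw(1,2)] linear_map_on_scale[OF R(1) h(1)[OF j(1)]] by (simp only:)
    then have "y + sc \<mu> (R (h j)) - R (?v + ?w) = y - R ?v" by simp
    also have "norm \<dots> \<le> \<eta>" using R3 by (simp only: s_def)
    finally have "norm (y + sc \<mu> (R (h j)) - R (?v + ?w)) \<le> \<eta>" .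
    then have "\<bar>norm (y + sc \<mu> (R (h j))) - norm (R (?v + ?w))\<bar> \<le> \<eta>"
      by (meson norm_triangle_ineq3 order_trans)
    moreover have "\<epsilon> * q \<le> \<epsilon> * L" "\<epsilon> * L \<le> \<eta> * L"
      using qL L0 \<epsilon> by (auto intro: mult_left_mono mult_right_mono)
    ultimately have "\<bar>norm (y + sc \<mu> (R (h j))) - L\<bar> \<le> \<eta> + \<eta> * L"
      using Rvw qL Lq by linarith
    then show ?thesis by (simp add: L_def algebra_simps)
  qed
  then show ?thesis using j R(2) h(1,3,4)[OF j(1)] by (intro bexI[of _ "R (h j)"]) auto
qed

end

section \<open>The game and its limits\<close>

lemma asymptotic_game_mono:
  assumes "asymptotic_game sc e \<Phi> n xs" "\<And>ys. \<Phi> ys \<Longrightarrow> \<Psi> ys"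
  shows "asymptotic_game sc e \<Psi> n xs"
  using assms(1)
proof (induction n arbitrary: xs)
  case (Suc n)
  then show ?case by (simp; blast)
qed (simp add: assms(2))

lemma asymptotic_game_False: "\<not> asymptotic_game sc e (\<lambda>_. False) n xs"
  by (induction n arbitrary: xs) auto

text \<open>If both goals could be refuted, playing the larger of the two bounds in each round would
  refute both at once, since a vector beyond the larger bound is beyond each of them.\<close>

lemma asymptotic_game_disj:
  assumes "asymptotic_game sc e (\<lambda>ys. \<Phi> ys \<or> \<Psi> ys) n xs"
  shows "asymptotic_game sc e \<Phi> n xs \<or> asymptotic_game sc e \<Psi> n xs"
  using assms
proof (induction n arbitrary: xs)
  case (Suc n)
  show ?case
  proof (rule ccontr)
    assume "\<not> (asymptotic_game sc e \<Phi> (Suc n) xs \<or> asymptotic_game sc e \<Psi> (Suc n) xs)"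
    then obtain m1 m2 where
      m: "\<And>x. supp_beyond sc e m1 x \<Longrightarrow> \<not> asymptotic_game sc e \<Phi> n (xs @ [x])"
        "\<And>x. supp_beyond sc e m2 x \<Longrightarrow> \<not> asymptotic_game sc e \<Psi> n (xs @ [x])"
      by auto
    obtain x where x: "supp_beyond sc e (max m1 m2) x"
      "asymptotic_game sc e (\<lambda>ys. \<Phi> ys \<or> \<Psi> ys) n (xs @ [x])"
      using Suc.prems unfolding asymptotic_game.simps by blast
    then have "supp_beyond sc e m1 x" "supp_beyond sc e m2 x"
      by (auto simp: supp_beyond_def)
    with m Suc.IH[OF x(2)] show False by blast
  qed
qed simp

text \<open>
  By the three lemmas above, winning the game is the same as being frequent along a filter on the
  outcomes of the game.
\<close>

definition game_filter ::
    "('k::real_normed_field \<Rightarrow> 'x::real_normed_vector \<Rightarrow> 'x) \<Rightarrow> (nat \<Rightarrow> 'x) \<Rightarrow> nat \<Rightarrow> 'x list filter" where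
  "game_filter sc e n = Abs_filter (\<lambda>P. \<not> asymptotic_game sc e (\<lambda>x. \<not> P x) n [])"

lemma frequently_game_filter:
  "frequently P (game_filter sc e n) \<longleftrightarrow> asymptotic_game sc e P n []"
proof -
  have "is_filter (\<lambda>P. \<not> asymptotic_game sc e (\<lambda>x. \<not> P x) n [])"
  proof (rule is_filter.intro)
    show "\<not> asymptotic_game sc e (\<lambda>x. \<not> True) n []"
      by (simp add: asymptotic_game_False)
    show "\<not> asymptotic_game sc e (\<lambda>x. \<not> (P x \<and> Q x)) n []"
      if "\<not> asymptotic_game sc e (\<lambda>x. \<not> P x) n []" "\<not> asymptotic_game sc e (\<lambda>x. \<not> Q x) n []"
      for P Q
      using that asymptotic_game_disj[of sc e "\<lambda>x. \<not> P x" "\<lambda>x. \<not> Q x" n "[]"] by auto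
    show "\<not> asymptotic_game sc e (\<lambda>x. \<not> Q x) n []"
      if "\<forall>x. P x \<longrightarrow> Q x" "\<not> asymptotic_game sc e (\<lambda>x. \<not> P x) n []" for P Q
      using that asymptotic_game_mono[of sc e "\<lambda>x. \<not> Q x" n "[]" "\<lambda>x. \<not> P x"] by blast
  qed
  then show ?thesis
    by (simp add: frequently_def game_filter_def eventually_Abs_filter)
qed

text \<open>A strategy given by an invariant: whatever \<open>m\<close> is played, \<open>P\<close>
  can be kept for one more round. The length is recorded so that \<open>P\<close> may quantify over
  all positions of the outcome.\<close>

lemma asymptotic_game_winI:
  assumes "\<And>xs m. P xs \<Longrightarrow> length xs < n \<Longrightarrow> \<exists>x. supp_beyond sc e m x \<and> P (xs @ [x])"
    and "P xs" "length xs + j = n"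
  shows "asymptotic_game sc e (\<lambda>ys. P ys \<and> length ys = n) j xs"
  using assms(2,3)
proof (induction j arbitrary: xs)
  case (Suc j)
  show ?case unfolding asymptotic_game.simps
  proof
    fix m
    obtain x where "supp_beyond sc e m x" "P (xs @ [x])" using assms(1)[of xs m] Suc.prems by auto
    then show "\<exists>x. supp_beyond sc e m x \<and> asymptotic_game sc e (\<lambda>ys. P ys \<and> length ys = n) j (xs @ [x])"
      using Suc.IH[of "xs @ [x]"] Suc.prems by auto
  qed
qed simp

text \<open>Plays the part of a convergent subnet: along the finer filter \<open>H\<close> the
  cluster point is a limit, and whatever holds eventually along \<open>F\<close> still holds
  eventually along \<open>H\<close>.\<close>

lemma cluster_point_filter:
  fixes f :: "'a \<Rightarrow> 'b::topological_space"
  assumes "compact K" "F \<noteq> bot" "eventually (\<lambda>x. f x \<in> K) F"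
  obtains H l where "H \<noteq> bot" "H \<le> F" "l \<in> K" "(f \<longlongrightarrow> l) H"
proof -
  have "filtermap f F \<noteq> bot" "eventually (\<lambda>y. y \<in> K) (filtermap f F)"
    using assms by (auto simp: filtermap_bot_iff eventually_filtermap)
  then obtain l where l: "l \<in> K" "inf (nhds l) (filtermap f F) \<noteq> bot"
    using assms(1) unfolding compact_filter by blast
  let ?H = "inf (filtercomap f (nhds l)) F"
  have "?H \<noteq> bot"
  proof
    assume "?H = bot"
    then have "eventually (\<lambda>_. False) ?H" by simp
    then obtain Q R where QR: "eventually Q (filtercomap f (nhds l))" "eventually R F"
      "\<And>x. \<not> (Q x \<and> R x)"
      unfolding eventually_inf by auto
    from QR(1) obtain Q' where Q': "eventually Q' (nhds l)" "\<And>x. Q' (f x) \<Longrightarrow> Q x"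
      unfolding eventually_filtercomap by blast
    have "eventually (\<lambda>y. \<not> Q' y) (filtermap f F)"
      unfolding eventually_filtermap by (rule eventually_mono[OF QR(2)]) (use QR(3) Q'(2) in blast)
    with Q'(1) have "eventually (\<lambda>_. False) (inf (nhds l) (filtermap f F))"
      unfolding eventually_inf by blast
    with l(2) show False by (simp add: eventually_False)
  qed
  moreover have "(f \<longlongrightarrow> l) ?H"
    by (rule filterlim_mono[OF filterlim_filtercomap order_refl]) simp
  ultimately show ?thesis using l(1) by (intro that[of ?H l]) auto
qed

lemma compact_Pi_UNIV:
  assumes "\<And>i. compact (S i)"
  shows "compact (PiE UNIV S)"
proof -
  have "compactin (product_topology (\<lambda>_. euclidean) UNIV) (PiE UNIV S)"
    using assms by (auto simp: compactin_PiE)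
  then show ?thesis by (simp add: euclidean_product_topology)
qed

lemma tendsto_apply:
  fixes f :: "'a \<Rightarrow> 'i \<Rightarrow> 'b::topological_space"
  assumes "(f \<longlongrightarrow> l) F"
  shows "((\<lambda>x. f x i) \<longlongrightarrow> l i) F"
proof (rule topological_tendstoI)
  fix U :: "'b set" assume "open U" "l i \<in> U"
  moreover have "open ((\<lambda>g::'i \<Rightarrow> 'b. g i) -` U)"
    by (rule open_vimage[OF \<open>open U\<close> continuous_on_product_coordinates])
  ultimately show "eventually (\<lambda>x. f x i \<in> U) F"
    using topological_tendstoD[OF assms, of "(\<lambda>g. g i) -` U"] by simp
qed

context banach_space_over
begin

text \<open>The game is won for each \<open>\<eta>\<close> separately, while a single norm has to
  serve every \<open>\<epsilon>\<close>. The assumption \<open>far\<close> is used both for positive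
  definiteness of the limit and for measuring errors relative to it.\<close>

lemma asymptotic_limit:
  fixes A :: "real \<Rightarrow> 'x list \<Rightarrow> bool"
  assumes win: "\<And>\<eta>. \<eta> > 0 \<Longrightarrow> asymptotic_game sc e (A \<eta>) n []"
    and mono: "\<And>\<eta> \<theta> x. A \<eta> x \<Longrightarrow> \<eta> \<le> \<theta> \<Longrightarrow> A \<theta> x"
    and unit: "\<And>\<eta> x j. A \<eta> x \<Longrightarrow> j < n \<Longrightarrow> norm (x ! j) = 1"
    and far: "\<And>\<eta> x j c. A \<eta> x \<Longrightarrow> j < n \<Longrightarrow> 1 / 4 \<le> norm ((\<Sum>i<j. sc (c i) (x ! i)) + x ! j)"
  obtains H N where "H \<noteq> bot" "\<And>\<eta>. \<eta> > 0 \<Longrightarrow> eventually (A \<eta>) H"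
    "\<And>f. ((\<lambda>x. norm (\<Sum>i<n. sc (f i) (x ! i))) \<longlongrightarrow> N f) H"
    "(ell_fin n, N, unit_seq) \<in> asymptotic_structure sc e n seq_sc"
proof -
  define \<nu> where "\<nu> = (\<lambda>x f. norm (\<Sum>i<n. sc (f i) (x ! i)))"
  let ?G = "game_filter sc e n"
  \<comment> \<open>By \<open>mono\<close> this infimum is directed, so it is proper as soon as each
    member is; and each is, because \<open>A \<eta>\<close> is frequent along the game
    filter.\<close>
  define F where "F = (INF \<eta>\<in>{0<..}. inf ?G (principal {x. A \<eta> x}))"
  have "F \<noteq> bot"
  proof
    assume "F = bot"
    then have "eventually (\<lambda>_. False) F" by simp
    moreover have "\<exists>\<theta>\<in>{0<..}. inf ?G (principal {x. A \<theta> x}) \<le>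
        inf (inf ?G (principal {x. A \<eta> x})) (inf ?G (principal {x. A \<eta>' x}))"
      if "\<eta> \<in> {0<..}" "\<eta>' \<in> {0<..}" for \<eta> \<eta>'
    proof (rule bexI[of _ "min \<eta> \<eta>'"])
      have "principal {x. A (min \<eta> \<eta>') x} \<le> principal {x. A \<eta> x}"
        "principal {x. A (min \<eta> \<eta>') x} \<le> principal {x. A \<eta>' x}"
        using mono by fastforce+
      then show "inf ?G (principal {x. A (min \<eta> \<eta>') x}) \<le>
          inf (inf ?G (principal {x. A \<eta> x})) (inf ?G (principal {x. A \<eta>' x}))"
        by (meson inf_greatest inf_le1 inf_mono order_refl)
    qed (use that in auto)
    ultimately obtain \<eta> where "\<eta> > 0" "eventually (\<lambda>_. False) (inf ?G (principal {x. A \<eta> x}))"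
      unfolding F_def by (subst (asm) eventually_INF_base) auto
    then show False
      using win[of \<eta>] unfolding frequently_game_filter[symmetric] eventually_inf_principal frequently_def
      by simp
  qed
  have F_A: "eventually (A \<eta>) F" if "\<eta> > 0" for \<eta>
    unfolding F_def using that by (intro eventually_INF1[of \<eta>]) (auto simp: eventually_inf_principal)
  have F_G: "F \<le> ?G"
    unfolding F_def by (rule INF_lower2[of 1]) auto
  \<comment> \<open>The triangle inequality for unit vectors confines the norm of every admissible
    outcome to a product of compact intervals, one factor for each coefficient sequence.\<close>
  define K :: "((nat \<Rightarrow> 'k) \<Rightarrow> real) set" where "K = PiE UNIV (\<lambda>f. {0..\<Sum>i<n. norm (f i)})"
  have \<nu>_upper: "\<nu> x f \<le> (\<Sum>i<n. norm (f i))" if "A \<eta> x" for \<eta> x f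
    unfolding \<nu>_def using unit[OF that] by (intro sum_norm_le) (simp add: norm_sc)
  have "eventually (\<lambda>x. \<nu> x \<in> K) F"
    using F_A[of 1, simplified]
    by (rule eventually_mono) (use \<nu>_upper in \<open>auto simp: K_def \<nu>_def PiE_iff\<close>)
  moreover have "compact K" unfolding K_def by (intro compact_Pi_UNIV) simp
  ultimately obtain H N where H: "H \<noteq> bot" "H \<le> F" and \<nu>N: "(\<nu> \<longlongrightarrow> N) H"
    using cluster_point_filter[OF _ \<open>F \<noteq> bot\<close>] by metis
  have lim: "((\<lambda>x. \<nu> x f) \<longlongrightarrow> N f) H" for f by (rule tendsto_apply[OF \<nu>N])
  have H_A: "eventually (A \<eta>) H" if "\<eta> > 0" for \<eta> using F_A[OF that] H(2) filter_leD by blast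
  have A1: "eventually (A 1) H" by (rule H_A) simp
  have \<nu>_scale: "\<nu> x (seq_sc c f) = norm c * \<nu> x f" for x c f
    unfolding \<nu>_def by (simp add: norm_sc flip: scale_scale scale_sum_right)
  have \<nu>_add: "\<nu> x (f + g) \<le> \<nu> x f + \<nu> x g" for x f g
    unfolding \<nu>_def by (simp add: scale_left_distrib sum.distrib norm_triangle_ineq)
  have N_scale: "N (seq_sc c f) = norm c * N f" for c f
    using tendsto_unique[OF H(1) lim[of "seq_sc c f"]] tendsto_mult_left[OF lim[of f], of "norm c"]
    unfolding \<nu>_scale by blast
  have N_add: "N (f + g) \<le> N f + N g" for f g
    by (rule tendsto_le[OF H(1) tendsto_add[OF lim lim] lim]) (use \<nu>_add in simp)
  have N_nonneg: "0 \<le> N f" for f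
    by (rule tendsto_lowerbound[OF lim _ H(1)]) (simp add: \<nu>_def)
  have N_upper: "N f \<le> (\<Sum>i<n. norm (f i))" for f
    by (rule tendsto_upperbound[OF lim _ H(1)]) (rule eventually_mono[OF A1], rule \<nu>_upper)
  have N_lower: "norm (f i) \<le> 4 * 5 ^ n * N f" if "i < n" for f i
  proof (rule tendsto_lowerbound[OF tendsto_mult_left[OF lim] _ H(1)])
    show "eventually (\<lambda>x. norm (f i) \<le> 4 * 5 ^ n * \<nu> x f) H"
      using A1
    proof (rule eventually_mono)
      fix x assume x: "A 1 x"
      show "norm (f i) \<le> 4 * 5 ^ n * \<nu> x f" unfolding \<nu>_def
        by (rule coeff_le_norm_combination[OF unit[OF x] far[OF x] that])
    qed
  qed
  have N_unit: "N (unit_seq j) = 1" if "j < n" for j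
  proof -
    have "\<nu> x (unit_seq j) = 1" if "A 1 x" for x
    proof -
      have "(\<Sum>i<n. sc (unit_seq j i) (x ! i)) = (\<Sum>i<n. if i = j then x ! j else 0)"
        by (intro sum.cong) auto
      then show ?thesis using unit[OF that \<open>j < n\<close>] \<open>j < n\<close> by (simp add: \<nu>_def)
    qed
    then have "((\<lambda>x. \<nu> x (unit_seq j)) \<longlongrightarrow> 1) H"
      by (intro tendsto_eventually eventually_mono[OF A1])
    then show ?thesis using tendsto_unique[OF H(1) lim] by blast
  qed
  have N_cong: "N f = N g" if "\<And>i. i < n \<Longrightarrow> f i = g i" for f g
  proof -
    have "\<nu> x f = \<nu> x g" for x unfolding \<nu>_def using that by (intro arg_cong[of _ _ norm] sum.cong) auto
    then show ?thesis using tendsto_unique[OF H(1) lim[of f]] lim[of g] by simp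
  qed
  \<comment> \<open>So far convergence is only pointwise in \<open>f\<close>. A finite net for the
    coefficient vectors with maximum at most 1, followed by homogeneity, makes it uniform.\<close>
  have approx: "eventually (\<lambda>x. \<forall>f. \<bar>\<nu> x f - N f\<bar> \<le> \<kappa> * N f) H" if "\<kappa> > 0" for \<kappa> :: real
  proof -
    \<comment> \<open>Passing to a net point costs \<open>n * \<eta>\<close> for each of the two
      norms, and comparing them there costs \<open>\<eta>\<close>. When the largest coefficient has
      modulus 1, \<open>N_lower\<close> bounds \<open>N\<close> below by
      \<open>1 / (4 * 5 ^ n)\<close>.\<close>
    define \<eta> where "\<eta> = \<kappa> / ((2 * real n + 1) * (4 * 5 ^ n))"
    have \<eta>: "\<eta> > 0" using that by (simp add: \<eta>_def)
    obtain S :: "'k set" where S: "finite S" "\<And>c. norm c \<le> 1 \<Longrightarrow> \<exists>s\<in>S. norm (c - s) < \<eta>"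
      using finite_net_cball[OF \<eta>] by blast
    let ?P = "PiE {..<n} (\<lambda>_. S)"
    have "finite ?P" using S by (intro finite_PiE) auto
    moreover have "eventually (\<lambda>x. \<bar>\<nu> x h - N h\<bar> < \<eta>) H" for h
      using tendstoD[OF lim \<eta>] by (simp add: dist_real_def)
    ultimately have "eventually (\<lambda>x. \<forall>h\<in>?P. \<bar>\<nu> x h - N h\<bar> < \<eta>) H"
      by (intro eventually_ball_finite) auto
    with A1 show ?thesis
    proof eventually_elim
      case (elim x)
      show ?case
      proof
        fix f :: "nat \<Rightarrow> 'k"
        show "\<bar>\<nu> x f - N f\<bar> \<le> \<kappa> * N f"
        proof (cases "\<forall>i<n. f i = 0")
          case True
          then have "N f = 0" "\<nu> x f = 0" using N_upper[of f] N_nonneg[of f] by (auto simp: \<nu>_def)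
          then show ?thesis by simp
        next
          case False
          define M where "M = Max ((\<lambda>i. norm (f i)) ` {..<n})"
          have "{..<n} \<noteq> {}" using False by auto
          then have "M \<in> (\<lambda>i. norm (f i)) ` {..<n}" unfolding M_def by (intro Max_in) auto
          then obtain i0 where i0: "i0 < n" "norm (f i0) = M" by auto
          have fM: "norm (f i) \<le> M" if "i < n" for i using that by (auto simp: M_def intro!: Max_ge)
          have "0 < M" using False fM by (metis less_le_trans zero_less_norm_iff)
          define g where "g = seq_sc (of_real (1 / M)) f"
          have g: "norm (g i) = norm (f i) / M" for i
            using \<open>0 < M\<close> by (simp add: g_def norm_mult norm_divide)
          have "\<forall>i. \<exists>s. i < n \<longrightarrow> s \<in> S \<and> norm (g i - s) < \<eta>"
            using S(2) g fM \<open>0 < M\<close> by (metis divide_le_eq_1_pos)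
          then obtain s where s: "\<And>i. i < n \<Longrightarrow> s i \<in> S \<and> norm (g i - s i) < \<eta>" by metis
          \<comment> \<open>Beyond \<open>n\<close> the entries of \<open>h\<close> are unspecified,
            which is harmless: both norms see only the first \<open>n\<close> entries.\<close>
          define h where "h = restrict s {..<n}"
          have h: "h \<in> ?P" "\<And>i. i < n \<Longrightarrow> norm (g i - h i) < \<eta>"
            using s by (auto simp: h_def split: if_splits)
          define d where "d = g + seq_sc (- 1) h"
          have d_le: "(\<Sum>i<n. norm (d i)) \<le> real n * \<eta>"
            using sum_bounded_above[of "{..<n}" "\<lambda>i. norm (d i)" \<eta>] h(2)
            by (auto simp: d_def less_imp_le)
          have gh: "g = h + d" "h = g + seq_sc (- 1) d" by (auto simp: d_def fun_eq_iff)
          have "\<nu> x d \<le> real n * \<eta>" "N d \<le> real n * \<eta>"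
            using \<nu>_upper[OF elim(1), of d] N_upper[of d] d_le by linarith+
          moreover have "\<nu> x g \<le> \<nu> x h + \<nu> x d" "N g \<le> N h + N d"
            by (subst gh(1), rule \<nu>_add N_add)+
          moreover have "\<nu> x h \<le> \<nu> x g + \<nu> x (seq_sc (- 1) d)" "N h \<le> N g + N (seq_sc (- 1) d)"
            by (subst gh(2), rule \<nu>_add N_add)+
          moreover have "\<nu> x (seq_sc (- 1) d) = \<nu> x d" "N (seq_sc (- 1) d) = N d"
            unfolding \<nu>_scale N_scale by simp_all
          moreover have "\<bar>\<nu> x h - N h\<bar> < \<eta>" using elim(2) h(1) by blast
          ultimately have "\<bar>\<nu> x g - N g\<bar> \<le> 2 * (real n * \<eta>) + \<eta>" by linarith
          also have "\<dots> = (2 * real n + 1) * \<eta>" by (simp add: algebra_simps)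
          also have "\<dots> = \<kappa> / (4 * 5 ^ n)"
          proof -
            have "2 * real n + 1 \<noteq> 0" by linarith
            then show ?thesis by (simp add: \<eta>_def)
          qed
          also have "\<dots> \<le> \<kappa> * N g"
          proof -
            have "1 \<le> 4 * 5 ^ n * N g" using N_lower[OF i0(1), of g] g[of i0] i0(2) \<open>0 < M\<close> by simp
            then have "\<kappa> * 1 \<le> \<kappa> * (4 * 5 ^ n * N g)" using that by (intro mult_left_mono) auto
            then show ?thesis by (simp add: field_simps)
          qed
          finally have "\<bar>\<nu> x g - N g\<bar> \<le> \<kappa> * N g" .
          moreover have "\<nu> x g = \<nu> x f / M" "N g = N f / M"
            unfolding g_def \<nu>_scale N_scale using \<open>0 < M\<close> by (simp_all add: norm_divide)
          ultimately have "\<bar>(\<nu> x f - N f) / M\<bar> \<le> \<kappa> * N f / M" by (simp add: diff_divide_distrib)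
          then show ?thesis using \<open>0 < M\<close> by (simp add: divide_le_cancel)
        qed
      qed
    qed
  qed
  have N_expand: "N (\<Sum>i<n. seq_sc (a i) (unit_seq i)) = N a" for a
    by (rule N_cong) (simp add: sum_unit_seq_apply del: seq_sc_apply)
  have game: "asymptotic_game sc e
      (\<lambda>x. \<exists>c C. 0 < c \<and> c \<le> C \<and> C / c < 1 + \<epsilon> \<and>
        (\<forall>a. c * N (\<Sum>i<n. seq_sc (a i) (unit_seq i)) \<le> norm (\<Sum>i<n. sc (a i) (x ! i)) \<and>
             norm (\<Sum>i<n. sc (a i) (x ! i)) \<le> C * N (\<Sum>i<n. seq_sc (a i) (unit_seq i)))) n []"
    (is "asymptotic_game sc e ?\<Phi> n []") if "\<epsilon> > 0" for \<epsilon> :: real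
  proof -
    \<comment> \<open>These bounds give \<open>2 * \<kappa> + \<epsilon> * \<kappa> \<le> 9 / 10 *
      \<epsilon> < \<epsilon>\<close>, which is what
      \<open>1 + \<kappa> < (1 + \<epsilon>) * (1 - \<kappa>)\<close> amounts to.\<close>
    define \<kappa> where "\<kappa> = min (1 / 2) (\<epsilon> / 5)"
    have \<kappa>: "0 < \<kappa>" "\<kappa> \<le> 1 / 2" "5 * \<kappa> \<le> \<epsilon>" using that by (auto simp: \<kappa>_def)
    have "\<epsilon> * \<kappa> \<le> \<epsilon> * (1 / 2)" using \<kappa> that by (intro mult_left_mono) auto
    moreover have "(1 + \<epsilon>) * (1 - \<kappa>) = 1 + \<epsilon> - \<kappa> - \<epsilon> * \<kappa>" by (simp add: algebra_simps)
    ultimately have "1 + \<kappa> < (1 + \<epsilon>) * (1 - \<kappa>)" using \<kappa> that by linarith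
    then have "(1 + \<kappa>) / (1 - \<kappa>) < 1 + \<epsilon>" using \<kappa> by (subst pos_divide_less_eq) auto
    then have *: "?\<Phi> x" if "\<forall>f. \<bar>\<nu> x f - N f\<bar> \<le> \<kappa> * N f" for x
      using that \<kappa> unfolding N_expand \<nu>_def abs_le_iff
      by (intro exI[of _ "1 - \<kappa>"] exI[of _ "1 + \<kappa>"]) (auto simp: algebra_simps)
    \<comment> \<open>Since \<open>H\<close> is proper and finer than the game filter, an event that
      is eventual along \<open>H\<close> is frequent along the game filter, so the game for it is
      won.\<close>
    have "eventually ?\<Phi> H" by (rule eventually_mono[OF approx[OF \<kappa>(1)]]) (rule *)
    then have "frequently ?\<Phi> H" using H(1) by (rule eventually_frequently[rotated])
    then have "frequently ?\<Phi> ?G"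
      unfolding frequently_def using filter_leD[OF order_trans[OF H(2) F_G]] by blast
    then show ?thesis unfolding frequently_game_filter .
  qed
  have N_0: "N f = 0 \<longleftrightarrow> f = 0" if "f \<in> ell_fin n" for f
  proof
    assume "N f = 0"
    then have "f i = 0" if "i < n" for i using N_lower[OF that, of f] by simp
    with that show "f = 0" unfolding ell_fin_def by (auto simp: fun_eq_iff not_le[symmetric])
  qed (use N_scale[of 0 0] in simp)
  have "normed_space_on seq_sc (ell_fin n) N"
    unfolding normed_space_on_def
    by (intro conjI allI ballI vector_space_seq_sc subspace_ell_fin N_nonneg N_0 N_scale N_add)
  moreover have "unit_vector_basis_of seq_sc n (ell_fin n) N unit_seq"
    unfolding unit_vector_basis_of_def
    by (intro conjI allI impI inj_on_subset[OF inj_unit_seq] independent_unit_seq span_unit_seq N_unit)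
      simp
  ultimately have "(ell_fin n, N, unit_seq) \<in> asymptotic_structure sc e n seq_sc"
    unfolding asymptotic_structure_def mem_Collect_eq prod.case
    by (intro conjI allI impI game)
  then show ?thesis
    using H(1) H_A lim unfolding \<nu>_def by (intro that[of H N])
qed

end

section \<open>The limit norm\<close>

text \<open>Allows the limit norm to be exchanged for \<open>ell_norm r\<close> once the two agree
  on the hosted space.\<close>

lemma asymptotic_structure_cong:
  assumes "(ell_fin n, N, unit_seq) \<in> asymptotic_structure sc e n seq_sc"
    and eq: "\<And>f. f \<in> ell_fin n \<Longrightarrow> N f = N' f"
  shows "(ell_fin n, N', unit_seq) \<in> asymptotic_structure sc e n seq_sc"
proof -
  note sub = seq.subspace_add[OF subspace_ell_fin[of n]] seq.subspace_scale[OF subspace_ell_fin[of n]]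
  have "normed_space_on seq_sc (ell_fin n) N \<longleftrightarrow> normed_space_on seq_sc (ell_fin n) N'"
    unfolding normed_space_on_def by (simp only: eq sub cong: ball_cong)
  moreover have "unit_vector_basis_of seq_sc n (ell_fin n) N unit_seq \<longleftrightarrow>
      unit_vector_basis_of seq_sc n (ell_fin n) N' unit_seq"
  proof -
    have "N (unit_seq i) = N' (unit_seq i)" if "i < n" for i
      using that by (intro eq) (auto simp: ell_fin_def)
    then show ?thesis unfolding unit_vector_basis_of_def by (metis (no_types, lifting))
  qed
  moreover have "N (\<Sum>i<n. seq_sc (a i) (unit_seq i)) = N' (\<Sum>i<n. seq_sc (a i) (unit_seq i))" for a
    by (rule eq) (simp add: ell_fin_def sum_unit_seq_apply del: seq_sc_apply)
  ultimately show ?thesis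
    using assms(1) unfolding asymptotic_structure_def by simp
qed

context banach_space_over
begin

section \<open>The one-step identity in the limit\<close>

lemma sum_scaled_prefix:
  assumes "k \<le> n"
  shows "(\<Sum>i<n. sc ((\<Sum>j<k. seq_sc (a j) (unit_seq j)) i) (x i)) = (\<Sum>i<k. sc (a i) (x i))"
  using assms
  by (intro sum.mono_neutral_cong_right) (auto simp: sum_unit_seq_apply simp del: seq_sc_apply)

lemma sum_scaled_prefix_add:
  assumes "k < n"
  shows "(\<Sum>i<n. sc (((\<Sum>j<k. seq_sc (a j) (unit_seq j)) + seq_sc \<mu> (unit_seq k)) i) (x i)) =
    (\<Sum>i<k. sc (a i) (x i)) + sc \<mu> (x k)"
proof -
  have "(\<Sum>i<n. sc (seq_sc \<mu> (unit_seq k) i) (x i)) = (\<Sum>i<n. if i = k then sc \<mu> (x k) else 0)"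
    by (intro sum.cong) auto
  then have "(\<Sum>i<n. sc (seq_sc \<mu> (unit_seq k) i) (x i)) = sc \<mu> (x k)"
    using assms by simp
  then show ?thesis
    using sum_scaled_prefix[of k n a x] assms
    by (simp add: scale_left_distrib sum.distrib del: seq_sc_apply)
qed

text \<open>All moves stay in \<open>Y\<close>, so the partial combination does too and almost
  transitivity applies again in the next round. Along the limiting filter the error bound holds for
  every \<open>\<eta>\<close>, and the approximate identities become exact.\<close>

lemma asymptotic_recursion:
  fixes e :: "nat \<Rightarrow> 'x"
  assumes basis: "normalized_schauder_basis sc e"
    and Y: "banach_subspace sc Y" "almost_transitive sc Y" "r \<in> FR sc Y"
  obtains N where "(ell_fin n, N, unit_seq) \<in> asymptotic_structure sc e n seq_sc"
    "\<And>k \<mu>. k < n \<Longrightarrow> N ((\<Sum>i<k. seq_sc (a i) (unit_seq i)) + seq_sc \<mu> (unit_seq k)) =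
      ell2 r (N (\<Sum>i<k. seq_sc (a i) (unit_seq i))) (norm \<mu>)"
proof -
  have r: "1 \<le> r" using Y(3) by (simp add: FR_def)
  define y where "y = (\<lambda>(x :: nat \<Rightarrow> 'x) k. \<Sum>i<k. sc (a i) (x i))"
  \<comment> \<open>The condition at position \<open>k\<close> mentions only the entries up to
    \<open>k\<close>, so later moves cannot destroy it.\<close>
  define Q where "Q = (\<lambda>\<eta> (x :: nat \<Rightarrow> 'x) k. x k \<in> Y \<and> norm (x k) = 1 \<and>
      (\<forall>c. 1 / 4 \<le> norm ((\<Sum>i<k. sc (c i) (x i)) + x k)) \<and>
      (\<forall>\<mu>. \<bar>norm (y x k + sc \<mu> (x k)) - ell2 r (norm (y x k)) (norm \<mu>)\<bar>
        \<le> \<eta> * (1 + ell2 r (norm (y x k)) (norm \<mu>))))"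
  define P where "P = (\<lambda>\<eta> xs. \<forall>k<length xs. Q \<eta> ((!) xs) k)"
  define A where "A = (\<lambda>\<eta> xs. P \<eta> xs \<and> length xs = n)"
  have Q_prefix: "Q \<eta> ((!) (xs @ [z])) k = Q \<eta> ((!) xs) k" if "k < length xs" for \<eta> xs z k
  proof -
    have "(\<Sum>i<k. sc (c i) ((xs @ [z]) ! i)) = (\<Sum>i<k. sc (c i) (xs ! i))" for c
      using that by (intro sum.cong) (auto simp: nth_append)
    then show ?thesis using that unfolding Q_def y_def by (simp add: nth_append)
  qed
  have step: "\<exists>z. supp_beyond sc e m z \<and> P \<eta> (xs @ [z])" if "P \<eta> xs" "\<eta> > 0" for \<eta> xs m
  proof -
    let ?k = "length xs"
    have xs: "xs ! j \<in> Y" "norm (xs ! j) = 1" "1 / 4 \<le> norm ((\<Sum>i<j. sc (c i) (xs ! i)) + xs ! j)"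
      if "j < ?k" for j c
      using \<open>P \<eta> xs\<close> that unfolding P_def Q_def by blast+
    have "subspace Y" using Y(1) by (simp add: banach_subspace_def)
    then have "y ((!) xs) ?k \<in> Y" unfolding y_def using xs(1) by (intro subspace_sum subspace_scale) auto
    from asymptotic_move[where x = "(!) xs" and k = ?k and m = m, OF basis Y xs(2,3) this \<open>\<eta> > 0\<close>] obtain z where
      z: "z \<in> Y" "norm z = 1" "supp_beyond sc e m z"
        "\<And>c. 1 / 4 \<le> norm ((\<Sum>i<?k. sc (c i) (xs ! i)) + z)"
        "\<And>\<mu>. \<bar>norm (y ((!) xs) ?k + sc \<mu> z) - ell2 r (norm (y ((!) xs) ?k)) (norm \<mu>)\<bar>
          \<le> \<eta> * (1 + ell2 r (norm (y ((!) xs) ?k)) (norm \<mu>))"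
      by blast
    have sums: "(\<Sum>i<?k. sc (c i) ((xs @ [z]) ! i)) = (\<Sum>i<?k. sc (c i) (xs ! i))" for c
      by (intro sum.cong) (auto simp: nth_append)
    have "Q \<eta> ((!) (xs @ [z])) ?k"
      using z unfolding Q_def y_def by (simp add: sums)
    then have "P \<eta> (xs @ [z])"
      using \<open>P \<eta> xs\<close> Q_prefix unfolding P_def by (auto simp: less_Suc_eq)
    with z(3) show ?thesis by blast
  qed
  have win: "asymptotic_game sc e (A \<eta>) n []" if "\<eta> > 0" for \<eta>
    unfolding A_def by (rule asymptotic_game_winI) (use step that in \<open>auto simp: P_def\<close>)
  have mono: "A \<theta> x" if "A \<eta> x" "\<eta> \<le> \<theta>" for \<eta> \<theta> x
  proof -
    have "Q \<theta> ((!) x) k" if "Q \<eta> ((!) x) k" for k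
    proof -
      have "\<eta> * (1 + ell2 r (norm (y ((!) x) k)) (norm \<mu>)) \<le> \<theta> * (1 + ell2 r (norm (y ((!) x) k)) (norm \<mu>))"
        for \<mu> :: 'k
        using \<open>\<eta> \<le> \<theta>\<close> ell2_nonneg[of "norm (y ((!) x) k)" "norm \<mu>" r] by (intro mult_right_mono) auto
      then show ?thesis using that unfolding Q_def by (meson order_trans)
    qed
    then show ?thesis using that(1) unfolding A_def P_def by blast
  qed
  have unit: "norm (x ! j) = 1" and far: "1 / 4 \<le> norm ((\<Sum>i<j. sc (c i) (x ! i)) + x ! j)"
    if "A \<eta> x" "j < n" for \<eta> x j c
    using that unfolding A_def P_def Q_def by blast+
  have "\<exists>H N. H \<noteq> bot \<and> (\<forall>\<eta>>0. eventually (A \<eta>) H) \<and>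
      (\<forall>f. ((\<lambda>x. norm (\<Sum>i<n. sc (f i) (x ! i))) \<longlongrightarrow> N f) H) \<and>
      (ell_fin n, N, unit_seq) \<in> asymptotic_structure sc e n seq_sc"
  proof (rule asymptotic_limit[of e A n])
    show "asymptotic_game sc e (A \<eta>) n []" if "\<eta> > 0" for \<eta> by (rule win[OF that])
    show "A \<theta> x" if "A \<eta> x" "\<eta> \<le> \<theta>" for \<eta> \<theta> x by (rule mono[OF that])
    show "norm (x ! j) = 1" if "A \<eta> x" "j < n" for \<eta> x j by (rule unit[OF that])
    show "1 / 4 \<le> norm ((\<Sum>i<j. sc (c i) (x ! i)) + x ! j)" if "A \<eta> x" "j < n" for \<eta> x j c
      by (rule far[OF that])
  qed blast
  then obtain H N where H: "H \<noteq> bot" "\<And>\<eta>. \<eta> > 0 \<Longrightarrow> eventually (A \<eta>) H"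
    and lim: "\<And>f. ((\<lambda>x. norm (\<Sum>i<n. sc (f i) (x ! i))) \<longlongrightarrow> N f) H"
    and N: "(ell_fin n, N, unit_seq) \<in> asymptotic_structure sc e n seq_sc"
    by blast
  have "N ((\<Sum>i<k. seq_sc (a i) (unit_seq i)) + seq_sc \<mu> (unit_seq k)) =
      ell2 r (N (\<Sum>i<k. seq_sc (a i) (unit_seq i))) (norm \<mu>)" (is "?U = ell2 r ?V _")
    if k: "k < n" for k \<mu>
  proof (rule ccontr)
    let ?L = "ell2 r ?V (norm \<mu>)"
    assume neq: "?U \<noteq> ?L"
    have U: "((\<lambda>x. norm (y ((!) x) k + sc \<mu> (x ! k))) \<longlongrightarrow> ?U) H"
      using lim[of "(\<Sum>i<k. seq_sc (a i) (unit_seq i)) + seq_sc \<mu> (unit_seq k)"]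
      unfolding sum_scaled_prefix_add[OF k] y_def .
    have V: "((\<lambda>x. norm (y ((!) x) k)) \<longlongrightarrow> ?V) H"
      using lim[of "\<Sum>i<k. seq_sc (a i) (unit_seq i)"]
      unfolding sum_scaled_prefix[OF less_imp_le[OF k]] y_def .
    have L: "((\<lambda>x. ell2 r (norm (y ((!) x) k)) (norm \<mu>)) \<longlongrightarrow> ?L) H"
      by (rule tendsto_ell2_left[OF r V]) simp
    have "0 \<le> ?V" by (rule tendsto_lowerbound[OF V _ H(1)]) simp
    then have L0: "0 \<le> ?L" by (simp add: ell2_nonneg)
    \<comment> \<open>With this choice the limiting inequality says that the gap is at most half of
      itself.\<close>
    define \<eta> where "\<eta> = \<bar>?U - ?L\<bar> / (2 * (1 + ?L))"
    have \<eta>: "\<eta> > 0" using neq L0 by (simp add: \<eta>_def)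
    have "\<bar>?U - ?L\<bar> \<le> \<eta> * (1 + ?L)"
    proof (rule tendsto_le[OF H(1)])
      show "((\<lambda>x. \<eta> * (1 + ell2 r (norm (y ((!) x) k)) (norm \<mu>))) \<longlongrightarrow> \<eta> * (1 + ?L)) H"
        by (intro tendsto_intros L)
      show "((\<lambda>x. \<bar>norm (y ((!) x) k + sc \<mu> (x ! k)) - ell2 r (norm (y ((!) x) k)) (norm \<mu>)\<bar>)
          \<longlongrightarrow> \<bar>?U - ?L\<bar>) H"
        by (intro tendsto_intros U L)
      show "eventually (\<lambda>x. \<bar>norm (y ((!) x) k + sc \<mu> (x ! k)) - ell2 r (norm (y ((!) x) k)) (norm \<mu>)\<bar>
          \<le> \<eta> * (1 + ell2 r (norm (y ((!) x) k)) (norm \<mu>))) H"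
        by (rule eventually_mono[OF H(2)[OF \<eta>]]) (use k in \<open>simp add: A_def P_def Q_def\<close>)
    qed
    also have "\<eta> * (1 + ?L) = \<bar>?U - ?L\<bar> / 2"
    proof -
      have "t / (2 * w) * w = t / 2" if "w \<noteq> 0" for t w :: real using that by simp
      moreover have "1 + ?L \<noteq> 0" using L0 by linarith
      ultimately show ?thesis unfolding \<eta>_def by blast
    qed
    finally have "\<bar>?U - ?L\<bar> \<le> 0" by simp
    then show False using neq by simp
  qed
  with N show ?thesis by (rule that)
qed

text \<open>Taking \<open>\<mu> = a k\<close> in the one-step identity produces the norm of the next
  partial combination. Hence \<open>N\<close> and \<open>ell_norm r\<close> satisfy the same
  recursion along the partial combinations, with the same initial value 0.\<close>

lemma asymptotic_ell_norm:
  fixes e :: "nat \<Rightarrow> 'x"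
  assumes "normalized_schauder_basis sc e"
    and "banach_subspace sc Y" "almost_transitive sc Y" "r \<in> FR sc Y"
  obtains N where "(ell_fin n, N, unit_seq) \<in> asymptotic_structure sc e n seq_sc"
    "\<And>k \<mu>. k < n \<Longrightarrow> N ((\<Sum>i<k. seq_sc (a i) (unit_seq i)) + seq_sc \<mu> (unit_seq k)) =
      ell_norm r ((\<Sum>i<k. seq_sc (a i) (unit_seq i)) + seq_sc \<mu> (unit_seq k))"
proof -
  have r: "1 \<le> r" using assms(4) by (simp add: FR_def)
  let ?y = "\<lambda>k. \<Sum>i<k. seq_sc (a i) (unit_seq i :: nat \<Rightarrow> 'k)"
  obtain N where N: "(ell_fin n, N, unit_seq) \<in> asymptotic_structure sc e n seq_sc"
    "\<And>k \<mu>. k < n \<Longrightarrow> N (?y k + seq_sc \<mu> (unit_seq k)) = ell2 r (N (?y k)) (norm \<mu>)"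
    using asymptotic_recursion[OF assms, of n a] by blast
  have y: "?y k \<in> ell_fin (Suc k)" "?y k k = 0" for k
    by (simp_all add: ell_fin_def sum_unit_seq_apply del: seq_sc_apply)
  have add_unit: "ell_norm r (?y k + seq_sc \<mu> (unit_seq k)) = ell2 r (ell_norm r (?y k)) (norm \<mu>)" for k \<mu>
    by (subst add.commute, subst ell2_commute, rule ell_norm_add_unit[OF r y lessI])
  have "N (?y k) = ell_norm r (?y k)" if "k \<le> n" for k
    using that
  proof (induction k)
    case 0
    have "normed_space_on seq_sc (ell_fin n) N" using N(1) by (simp add: asymptotic_structure_def)
    moreover have "0 \<in> (ell_fin n :: (nat \<Rightarrow> 'k) set)" by (simp add: ell_fin_def)
    ultimately have "N 0 = 0" unfolding normed_space_on_def by blast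
    then show ?case by (simp only: lessThan_0 sum.empty ell_norm_zero)
  next
    case (Suc k)
    then have k: "k < n" by simp
    have IH: "N (?y k) = ell_norm r (?y k)" by (rule Suc.IH) (use k in simp)
    from N(2)[OF k] show ?case by (simp only: sum.lessThan_Suc add_unit IH)
  qed
  then have "N (?y k + seq_sc \<mu> (unit_seq k)) = ell_norm r (?y k + seq_sc \<mu> (unit_seq k))"
    if "k < n" for k \<mu>
    using N(2)[OF that] that unfolding add_unit by simp
  with N(1) show ?thesis by (rule that)
qed

end

section \<open>Explicit formulas and the plane\<close>

lemma ell_norm_prefix:
  assumes "1 \<le> r" "1 \<le> k"
  shows "ell_norm r ((\<Sum>i<k. seq_sc (a i) (unit_seq i)) + seq_sc \<mu> (unit_seq k)) =
    (if r = \<infinity> then Max (insert (norm \<mu>) ((\<lambda>i. norm (a i)) ` {..<k}))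
     else ((\<Sum>i<k. norm (a i) powr real_of_ereal r) + norm \<mu> powr real_of_ereal r)
       powr (1 / real_of_ereal r))"
proof -
  let ?f = "(\<Sum>i<k. seq_sc (a i) (unit_seq i)) + seq_sc \<mu> (unit_seq k)"
  have fi: "?f i = (if i < k then a i else if i = k then \<mu> else 0)" for i
    by (simp add: sum_unit_seq_apply del: seq_sc_apply) simp
  have f: "?f \<in> ell_fin (Suc k)" unfolding ell_fin_def mem_Collect_eq fi by simp
  show ?thesis
  proof (cases "r = \<infinity>")
    case True
    let ?M = "Max (insert (norm \<mu>) ((\<lambda>i. norm (a i)) ` {..<k}))"
    have sup: "ell_norm r ?f = (SUP i. norm (?f i))"
      using True unfolding ell_norm_def by (rule if_P)
    have "ell_norm r ?f \<le> ?M"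
      unfolding sup
    proof (rule cSUP_least)
      fix i
      \<comment> \<open>The entries of \<open>?f\<close> after position \<open>k\<close> are zero
        and take part in the supremum, so the maximum has to dominate 0 as well.\<close>
      have "0 \<le> ?M" by (rule order_trans[OF norm_ge_zero[of \<mu>]]) simp
      then show "norm (?f i) \<le> ?M" unfolding fi by (auto intro!: Max_ge)
    qed simp
    moreover have "?M \<le> ell_norm r ?f"
    proof (rule Max.boundedI)
      have le: "norm (?f i) \<le> ell_norm r ?f" for i by (rule norm_le_ell_norm[OF assms(1) f])
      have "norm \<mu> \<le> ell_norm r ?f" using le[of k] unfolding fi[of k] by simp
      moreover have "norm (a i) \<le> ell_norm r ?f" if "i < k" for i
        using le[of i] that unfolding fi[of i] by simp
      ultimately show "t \<le> ell_norm r ?f" if "t \<in> insert (norm \<mu>) ((\<lambda>i. norm (a i)) ` {..<k})" for t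
        using that by blast
    qed auto
    ultimately have "ell_norm r ?f = ?M" by (rule antisym)
    then show ?thesis unfolding if_P[OF True] .
  next
    case False
    have "(\<Sum>i<Suc k. norm (?f i) powr real_of_ereal r) =
        (\<Sum>i<k. norm (a i) powr real_of_ereal r) + norm \<mu> powr real_of_ereal r"
      unfolding fi by simp
    then show ?thesis using False unfolding ell_norm_ell_fin[OF f False] by simp
  qed
qed

text \<open>With the prescribed scalar 1, the norm is known at \<open>unit_seq 0\<close> plus any
  multiple of \<open>unit_seq 1\<close>. Every vector of the plane is a multiple of such a vector or
  of \<open>unit_seq 1\<close> itself, so homogeneity determines the norm completely.\<close>

lemma (in banach_space_over) ell_2_asymptotic:
  fixes e :: "nat \<Rightarrow> 'x"
  assumes "normalized_schauder_basis sc e"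
    and "banach_subspace sc Y" "almost_transitive sc Y" "r \<in> FR sc Y"
  shows "(ell_fin 2, ell_norm r, unit_seq) \<in> asymptotic_structure sc e 2 seq_sc"
proof -
  have r: "1 \<le> r" using assms(4) by (simp add: FR_def)
  let ?e = "unit_seq :: nat \<Rightarrow> nat \<Rightarrow> 'k"
  obtain N where N: "(ell_fin 2, N, unit_seq) \<in> asymptotic_structure sc e 2 seq_sc"
    "\<And>k \<mu>. k < 2 \<Longrightarrow> N ((\<Sum>i<k. seq_sc 1 (?e i)) + seq_sc \<mu> (?e k)) =
      ell_norm r ((\<Sum>i<k. seq_sc 1 (?e i)) + seq_sc \<mu> (?e k))"
    using asymptotic_ell_norm[OF assms, of 2 "\<lambda>_. 1"] by blast
  have N_scale: "N (seq_sc c f) = norm c * N f" if "f \<in> ell_fin 2" for c f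
    using N(1) that unfolding asymptotic_structure_def normed_space_on_def by blast
  have "N f = ell_norm r f" if f: "f \<in> ell_fin 2" for f
  proof (cases "f 0 = 0")
    case True
    have "f = seq_sc (f 1) (?e 1)"
    proof
      fix i show "f i = seq_sc (f 1) (?e 1) i"
        using f True by (cases "i = 0"; cases "i = 1") (auto simp: ell_fin_def)
    qed
    moreover have "N (?e 1) = 1"
      using N(1) unfolding asymptotic_structure_def unit_vector_basis_of_def by auto
    moreover have "?e 1 \<in> ell_fin 2" by (auto simp: ell_fin_def)
    ultimately show ?thesis using N_scale[of "?e 1" "f 1"] ell_norm_unit[OF r, of "f 1" 1] by simp
  next
    case False
    let ?g = "(\<Sum>i<1. seq_sc 1 (?e i)) + seq_sc (f 1 / f 0) (?e 1)"
    have "f = seq_sc (f 0) ?g"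
    proof
      fix i show "f i = seq_sc (f 0) ?g i"
        using f False by (cases "i = 0"; cases "i = 1") (auto simp: ell_fin_def)
    qed
    moreover have "?g \<in> ell_fin 2" by (auto simp: ell_fin_def)
    ultimately show ?thesis
      using N(2)[of 1 "f 1 / f 0"] N_scale[of ?g "f 0"] ell_norm_scale[OF r, of ?g 2 "f 0"]
      by (metis one_less_numeral_iff semiring_norm(76))
  qed
  then show ?thesis by (rule asymptotic_structure_cong[OF N(1)])
qed

theorem theorem2p8:
  fixes sc :: "'k::{real_normed_field, heine_borel} \<Rightarrow> 'x::banach \<Rightarrow> 'x"
    and e :: "nat \<Rightarrow> 'x" and Y :: "'x set" and r :: ereal
  assumes "banach_space_over sc"
    and "normalized_schauder_basis sc e"
    and "banach_subspace sc Y"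
    and "almost_transitive sc Y"
    and "r \<in> FR sc Y"
  shows "(\<forall>n\<ge>2. \<forall>a :: nat \<Rightarrow> 'k. (\<forall>i<n - 1. a i \<noteq> 0) \<longrightarrow>
            (\<exists>(V :: (nat \<Rightarrow> 'k) set) N b.
               (V, N, b) \<in> asymptotic_structure sc e n seq_sc \<and>
               (\<forall>\<mu>. \<forall>k. 1 \<le> k \<and> k < n \<longrightarrow>
                  N ((\<Sum>i<k. seq_sc (a i) (b i)) + seq_sc \<mu> (b k)) =
                  (if r = \<infinity> then Max (insert (norm \<mu>) ((\<lambda>i. norm (a i)) ` {..<k}))
                   else ((\<Sum>i<k. norm (a i) powr real_of_ereal r) + norm \<mu> powr real_of_ereal r)
                          powr (1 / real_of_ereal r))))) \<and>
         (ell_fin 2, ell_norm r, unit_seq) \<in> asymptotic_structure sc e 2 seq_sc"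
proof -
  interpret banach_space_over sc by (rule assms(1))
  have r: "1 \<le> r" using assms(5) by (simp add: FR_def)
  show ?thesis
  proof (intro conjI allI impI)
    fix n :: nat and a :: "nat \<Rightarrow> 'k"
    obtain N where N: "(ell_fin n, N, unit_seq) \<in> asymptotic_structure sc e n seq_sc"
      "\<And>k \<mu>. k < n \<Longrightarrow> N ((\<Sum>i<k. seq_sc (a i) (unit_seq i)) + seq_sc \<mu> (unit_seq k)) =
        ell_norm r ((\<Sum>i<k. seq_sc (a i) (unit_seq i)) + seq_sc \<mu> (unit_seq k))"
      using asymptotic_ell_norm[OF assms(2-5), of n a] by blast
    show "\<exists>(V :: (nat \<Rightarrow> 'k) set) N b.
       (V, N, b) \<in> asymptotic_structure sc e n seq_sc \<and>
       (\<forall>\<mu>. \<forall>k. 1 \<le> k \<and> k < n \<longrightarrow>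
          N ((\<Sum>i<k. seq_sc (a i) (b i)) + seq_sc \<mu> (b k)) =
          (if r = \<infinity> then Max (insert (norm \<mu>) ((\<lambda>i. norm (a i)) ` {..<k}))
           else ((\<Sum>i<k. norm (a i) powr real_of_ereal r) + norm \<mu> powr real_of_ereal r)
                  powr (1 / real_of_ereal r)))"
      using N(1) N(2)[unfolded ell_norm_prefix[OF r]]
      by (intro exI[of _ "ell_fin n"] exI[of _ N] exI[of _ unit_seq]) (auto simp: N(2) ell_norm_prefix[OF r])
  qed (rule ell_2_asymptotic[OF assms(2-5)])
qed

end
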